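(* There exist absolute constants $\varepsilon_0>0$ and $C>0$ with the following property. Let $0<\varepsilon<\varepsilon_0$ and let $f:\mathbb{H}\to\mathbb{H}$ be a $(1+\varepsilon)$-biLipschitz map such that $f(0)=0$. Then, after possibly applying the isometry $J(x,y,t)=(x,-y,-t)$ (that is, for $g=f$ or for $g=J\circ f$), $$d\big(g(0;t),(0;t)\big)\le C\varepsilon^{1/32}\,d\big((0;0),(0;t)\big)\qquad\text{for all } t\in\mathbb{R}.$$
   Context: The Heisenberg group $\mathbb{H}$ is $\mathbb{R}^3$, with points written $(x,y,t)=(z;t)$, $z=x+iy\in\mathbb{C}$, and product $(x,y,t)\cdot(x',y',t')=(x+x',y+y',t+t'+2(x'y-xy'))$. Left-invariant horizontal fields: $X=\partial_x+2y\,\partial_t$, $Y=\partial_y-2x\,\partial_t$. A horizontal curve is an absolutely continuous $\gamma:[\alpha,\beta]\to\mathbb{H}$ with $\dot\gamma=aX_\gamma+bY_\gamma$ a.e. for some measurable $a,b$; its length is $\int_\alpha^\beta\sqrt{a^2+b^2}$. The control distance $d(P,Q)$ is the infimum of lengths of horizontal curves joining $P$ and $Q$. A map $f:\mathbb{H}\to\mathbb{H}$ is $(1+\varepsilon)$-biLipschitz if $(1+\varepsilon)^{-1}d(P,Q)\le d(f(P),f(Q))\le(1+\varepsilon)d(P,Q)$ for all $P,Q\in\mathbb{H}$. *)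

theory Defs
  imports "HOL-Analysis.Analysis"
begin

text \<open>The triple \<open>(x, y, t)\<close> stands for the point \<open>(z; t)\<close> with \<open>z = x + i y\<close>; in particular
  \<open>(0; t)\<close> is \<open>(0, 0, t)\<close>. The topology, norm and derivatives that come with this type are the
  Euclidean ones of \<open>\<real>\<^sup>3\<close>; the control distance is the separate function \<open>heis_dist\<close> below.\<close>

type_synonym heis = "real \<times> real \<times> real"

definition heis_mult :: "heis \<Rightarrow> heis \<Rightarrow> heis" where
  "heis_mult = (\<lambda>(x, y, t) (x', y', t'). (x + x', y + y', t + t' + 2 * (x' * y - x * y')))"

definition heis_X :: "heis \<Rightarrow> heis" where
  "heis_X = (\<lambda>(x, y, t). (1, 0, 2 * y))"

definition heis_Y :: "heis \<Rightarrow> heis" where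
  "heis_Y = (\<lambda>(x, y, t). (0, 1, - 2 * x))"

text \<open>The two fields are the left-invariant ones for \<open>heis_mult\<close> extending the first two
  coordinate vectors at the identity.\<close>

lemma heis_X_left_invariant:
  "((\<lambda>s. heis_mult P (s, 0, 0)) has_vector_derivative heis_X P) (at 0)"
  by (cases P) (auto simp: heis_mult_def heis_X_def intro!: derivative_eq_intros has_vector_derivative_Pair)

lemma heis_Y_left_invariant:
  "((\<lambda>s. heis_mult P (0, s, 0)) has_vector_derivative heis_Y P) (at 0)"
  by (cases P) (auto simp: heis_mult_def heis_Y_def intro!: derivative_eq_intros has_vector_derivative_Pair)

text \<open>Absolute continuity of a curve (not of measures). A finite family of intervals \<open>(u, v)\<close> is
  given by the set of its pairs of endpoints.\<close>

definition abs_continuous_curve :: "real \<Rightarrow> real \<Rightarrow> (real \<Rightarrow> 'a::real_normed_vector) \<Rightarrow> bool" where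
  "abs_continuous_curve \<alpha> \<beta> \<gamma> \<longleftrightarrow>
     (\<forall>e>0. \<exists>\<delta>>0. \<forall>D. finite D \<longrightarrow>
        (\<forall>(u, v)\<in>D. \<alpha> \<le> u \<and> u < v \<and> v \<le> \<beta>) \<longrightarrow>
        disjoint_family_on (\<lambda>(u, v). {u<..<v}) D \<longrightarrow>
        (\<Sum>(u, v)\<in>D. v - u) < \<delta> \<longrightarrow>
        (\<Sum>(u, v)\<in>D. norm (\<gamma> v - \<gamma> u)) < e)"

definition horizontal_curve ::
    "real \<Rightarrow> real \<Rightarrow> (real \<Rightarrow> heis) \<Rightarrow> (real \<Rightarrow> real) \<Rightarrow> (real \<Rightarrow> real) \<Rightarrow> bool" where
  "horizontal_curve \<alpha> \<beta> \<gamma> a b \<longleftrightarrow>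
     \<alpha> < \<beta> \<and> abs_continuous_curve \<alpha> \<beta> \<gamma> \<and>
     a \<in> borel_measurable (lebesgue_on {\<alpha>..\<beta>}) \<and>
     b \<in> borel_measurable (lebesgue_on {\<alpha>..\<beta>}) \<and>
     (AE s in lebesgue_on {\<alpha>..\<beta>}.
        (\<gamma> has_vector_derivative a s *\<^sub>R heis_X (\<gamma> s) + b s *\<^sub>R heis_Y (\<gamma> s))
          (at s within {\<alpha>..\<beta>}))"

text \<open>Asking that the length integral has a value \<open>L\<close> excludes no horizontal curve: \<open>a\<close> and \<open>b\<close>
  agree almost everywhere with the derivatives of the first two components of \<open>\<gamma>\<close>, which are
  integrable because \<open>\<gamma>\<close> is absolutely continuous. As the integrand is nonnegative, the
  gauge integral is the Lebesgue integral.\<close>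

definition heis_dist :: "heis \<Rightarrow> heis \<Rightarrow> real" where
  "heis_dist P Q = Inf {L. \<exists>\<alpha> \<beta> \<gamma> a b. horizontal_curve \<alpha> \<beta> \<gamma> a b \<and> \<gamma> \<alpha> = P \<and> \<gamma> \<beta> = Q \<and>
     ((\<lambda>s. sqrt ((a s)\<^sup>2 + (b s)\<^sup>2)) has_integral L) {\<alpha>..\<beta>}}"

definition heis_bilipschitz :: "real \<Rightarrow> (heis \<Rightarrow> heis) \<Rightarrow> bool" where
  "heis_bilipschitz K f \<longleftrightarrow>
     (\<forall>P Q. inverse K * heis_dist P Q \<le> heis_dist (f P) (f Q) \<and>
            heis_dist (f P) (f Q) \<le> K * heis_dist P Q)"

definition heis_J :: "heis \<Rightarrow> heis" where
  "heis_J = (\<lambda>(x, y, t). (x, - y, - t))"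

end

theory Submission
  imports Defs
begin

text \<open>A vertical segment from \<open>0\<close> to \<open>(0; t)\<close> has a whole circle of midpoints, whereas for a point
  \<open>Q = (q; s)\<close> with \<open>q \<noteq> 0\<close> the approximate midpoints have nearly the same horizontal part. This is
  quantified by the sharp inequality \<open>d(0, (z; t))\<^sup>2 \<ge> \<theta> t + \<theta> cot \<theta> |z|\<^sup>2\<close> for \<open>|\<theta>| < \<pi>\<close>, with equality
  for the angle of a circular arc that joins the two points. Let \<open>\<theta>\<close> be the angle of \<open>Q\<close> and apply
  the inequality with \<open>\<theta> / 2\<close> to the two halves of a path through \<open>P = (p; u)\<close>. Completing the square
  gives \<open>2 (d(0, P)\<^sup>2 + d(P, Q)\<^sup>2) \<ge> d(0, Q)\<^sup>2 + 4 h |p - c|\<^sup>2\<close>, where \<open>h = (\<theta> / 2) cot (\<theta> / 2)\<close> and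
  \<open>c\<close> depends only on \<open>Q\<close> and \<open>\<theta>\<close>.

  For \<open>Q = f(0; t)\<close> take the images \<open>P\<close> of three midpoints that form an equilateral triangle. Three
  nearly equidistant points cannot lie near a vertical line, so \<open>h\<close> is at most of order \<open>\<epsilon>\<close>, and so is
  \<open>|q|\<close> relative to the distance. The height of \<open>Q\<close> is then close to \<open>t\<close> or \<open>-t\<close>. The choice of sign
  is the same for \<open>t\<close> and \<open>t'\<close> if \<open>t \<le> t' \<le> 2 t\<close>, and opposite for \<open>t\<close> and \<open>-t\<close>, since otherwise
  \<open>f\<close> would distort a distance too much. The distance bound obtained in the end is of order
  \<open>\<epsilon>\<^sup>1\<^sup>/\<^sup>2\<close>.\<close>

section \<open>Absolutely continuous curves\<close>

text \<open>Converts the part of a gauge division with tags in an exceptional set into a family of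
  endpoint pairs as quantified over in \<open>abs_continuous_curve\<close>. Degenerate intervals are
  dropped because that definition requires \<open>u < v\<close>.\<close>

lemma tagged_partial_division_reindex_endpoints:
  fixes p :: "(real \<times> real set) set" and g :: "real \<Rightarrow> real \<Rightarrow> 'b::comm_monoid_add"
  assumes p: "p tagged_partial_division_of {\<alpha>..\<beta>}"
  defines "q \<equiv> {(x, K) \<in> p. Inf K < Sup K}"
  defines "D \<equiv> (\<lambda>(x, K). (Inf K, Sup K)) ` q"
  shows "finite D" "\<forall>(u, v)\<in>D. \<alpha> \<le> u \<and> u < v \<and> v \<le> \<beta>"
    "disjoint_family_on (\<lambda>(u, v). {u<..<v}) D"
    "(\<Sum>(u, v)\<in>D. g u v) = (\<Sum>(x, K)\<in>q. g (Inf K) (Sup K))"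
proof -
  have fq: "finite q"
    using tagged_partial_division_ofD(1)[OF p] unfolding q_def by (rule rev_finite_subset) auto
  then show "finite D" unfolding D_def by simp
  have K: "{Inf K..Sup K} = K \<and> \<alpha> \<le> Inf K \<and> Sup K \<le> \<beta>" if "(x, K) \<in> q" for x K
  proof -
    have xp: "(x, K) \<in> p" using that by (auto simp: q_def)
    obtain a b where ab: "K = cbox a b" using tagged_partial_division_ofD(4)[OF p xp] by blast
    have "x \<in> K" using tagged_partial_division_ofD(2)[OF p xp] .
    then have le: "a \<le> b" using ab by auto
    have "K \<subseteq> {\<alpha>..\<beta>}" using tagged_partial_division_ofD(3)[OF p xp] .
    then show ?thesis using ab le by (auto simp: cbox_interval)
  qed
  then show "\<forall>(u, v)\<in>D. \<alpha> \<le> u \<and> u < v \<and> v \<le> \<beta>"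
    by (auto simp: D_def q_def)
  have disj: "{Inf K<..<Sup K} \<inter> {Inf K'<..<Sup K'} = {}"
    if "(x, K) \<in> q" "(x', K') \<in> q" "(x, K) \<noteq> (x', K')" for x K x' K'
  proof -
    have "interior K \<inter> interior K' = {}"
      by (rule tagged_partial_division_ofD(5)[OF p]) (use that in \<open>auto simp: q_def\<close>)
    then show ?thesis using K[OF that(1)] K[OF that(2)] by (metis interior_atLeastAtMost_real)
  qed
  show "disjoint_family_on (\<lambda>(u, v). {u<..<v}) D"
    unfolding disjoint_family_on_def D_def using disj by fastforce
  \<comment> \<open>Two different members with equal endpoints would share a nonempty open interval,
    contradicting disjoint interiors; hence sums over \<open>D\<close> and over \<open>q\<close>
    agree.\<close>
  have inj: "inj_on (\<lambda>(x, K). (Inf K, Sup K)) q"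
  proof (rule inj_onI, clarify)
    fix x K x' K' assume h: "(x, K) \<in> q" "(x', K') \<in> q" "Inf K = Inf K'" "Sup K = Sup K'"
    have "{Inf K<..<Sup K} \<noteq> {}" using h(1) by (auto simp: q_def)
    then show "x = x' \<and> K = K'" using disj[OF h(1,2)] h(3,4) by auto
  qed
  show "(\<Sum>(u, v)\<in>D. g u v) = (\<Sum>(x, K)\<in>q. g (Inf K) (Sup K))"
    unfolding D_def by (subst sum.reindex[OF inj]) (simp add: case_prod_unfold)
qed

text \<open>The fundamental theorem of calculus for absolutely continuous curves, proved directly
  with gauges. At tags where the derivative exists, the increment is approximated linearly;
  intervals tagged in \<open>S\<close> are forced into an open set of small measure, where absolute
  continuity bounds the sum of the increments. Integrability of \<open>\<gamma>'\<close> is part of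
  the conclusion.\<close>

theorem abs_continuous_has_integral:
  fixes \<gamma> :: "real \<Rightarrow> 'a::banach"
  assumes "\<alpha> \<le> \<beta>" and ac: "abs_continuous_curve \<alpha> \<beta> \<gamma>" and S: "negligible S"
    and deriv: "\<And>s. s \<in> {\<alpha>..\<beta>} - S \<Longrightarrow> (\<gamma> has_vector_derivative \<gamma>' s) (at s within {\<alpha>..\<beta>})"
  shows "(\<gamma>' has_integral (\<gamma> \<beta> - \<gamma> \<alpha>)) {\<alpha>..\<beta>}"
proof -
  \<comment> \<open>With the value 0 on \<open>S\<close>, a Riemann term with tag in
    \<open>S\<close> leaves only the increment of \<open>\<gamma>\<close>.\<close>
  define f where "f s = (if s \<in> S then 0 else \<gamma>' s)" for s
  have "(f has_integral (\<gamma> \<beta> - \<gamma> \<alpha>)) {\<alpha>..\<beta>}"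
    unfolding has_integral_real
  proof (intro allI impI)
    fix e :: real assume e: "e > 0"
    \<comment> \<open>The linear errors will add up to at most
      \<open>c * (\<beta> - \<alpha>) < e / 2\<close>; the summand 1 keeps the denominator positive
      when \<open>\<alpha> = \<beta>\<close>.\<close>
    define c where "c = e / (2 * (\<beta> - \<alpha> + 1))"
    have c: "c > 0" "c * (\<beta> - \<alpha>) < e / 2"
      using e \<open>\<alpha> \<le> \<beta>\<close> by (auto simp: c_def field_simps)
    have "e / 2 > 0" using e by simp
    then obtain \<delta> where \<delta>: "\<delta> > 0" and small: "\<And>D. \<lbrakk>finite D; \<forall>(u, v)\<in>D. \<alpha> \<le> u \<and> u < v \<and> v \<le> \<beta>;
        disjoint_family_on (\<lambda>(u, v). {u<..<v}) D; (\<Sum>(u, v)\<in>D. v - u) < \<delta>\<rbrakk>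
        \<Longrightarrow> (\<Sum>(u, v)\<in>D. norm (\<gamma> v - \<gamma> u)) < e / 2"
      using ac unfolding abs_continuous_curve_def by meson
    obtain U where U: "open U" "S \<subseteq> U" "U - S \<in> lmeasurable" "emeasure lebesgue (U - S) < ennreal \<delta>"
      using sets_lebesgue_outer_open[OF negligible_imp_sets[OF S] \<delta>] .
    have Sn: "S \<in> null_sets lebesgue" using S negligible_iff_null_sets by blast
    have US: "U = (U - S) \<union> S" using U(2) by auto
    have Um: "U \<in> lmeasurable"
      by (subst US, rule fmeasurable.Un[OF U(3)]) (use S negligible_iff_measure in blast)
    have "emeasure lebesgue U = emeasure lebesgue (U - S)"
      using emeasure_Diff_null_set[OF Sn fmeasurableD[OF Um]] by simp
    then have Ud: "measure lebesgue U < \<delta>"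
      using U(4) Um \<delta> by (metis emeasure_eq_measure2 ennreal_less_iff measure_nonneg)
    have "\<exists>d>0. \<forall>y\<in>{\<alpha>..\<beta>}. norm (y - s) < d \<longrightarrow>
            norm (\<gamma> y - \<gamma> s - (y - s) *\<^sub>R \<gamma>' s) \<le> c * norm (y - s)"
      if "s \<in> {\<alpha>..\<beta>} - S" for s
      using deriv[OF that] c(1) unfolding has_vector_derivative_def has_derivative_within_alt by blast
    then obtain d where d: "\<And>s. s \<in> {\<alpha>..\<beta>} - S \<Longrightarrow> d s > 0"
      "\<And>s y. \<lbrakk>s \<in> {\<alpha>..\<beta>} - S; y \<in> {\<alpha>..\<beta>}; norm (y - s) < d s\<rbrakk> \<Longrightarrow>
            norm (\<gamma> y - \<gamma> s - (y - s) *\<^sub>R \<gamma>' s) \<le> c * norm (y - s)" by metis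
    \<comment> \<open>Tags in \<open>S\<close> get \<open>U\<close>, other tags of the interval get
      the ball of differentiability; the last branch only makes \<open>G\<close> a gauge on the
      whole line.\<close>
    define G where "G s = (if s \<in> S then U else if s \<in> {\<alpha>..\<beta>} then ball s (d s) else ball s 1)" for s
    have gG: "gauge G"
      unfolding gauge_def G_def using U d(1) by auto
    show "\<exists>G. gauge G \<and> (\<forall>p. p tagged_division_of {\<alpha>..\<beta>} \<and> G fine p \<longrightarrow>
        norm ((\<Sum>(x, K)\<in>p. measure lborel K *\<^sub>R f x) - (\<gamma> \<beta> - \<gamma> \<alpha>)) < e)"
    proof (intro exI[of _ G] conjI gG allI impI, elim conjE)
      fix p assume p: "p tagged_division_of {\<alpha>..\<beta>}" and fine: "G fine p"
      define bad where "bad = {(x, K) \<in> p. x \<in> S}"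
      have finp: "finite p" using p by auto
      have badp: "bad \<subseteq> p" by (auto simp: bad_def)
      have bp: "bad tagged_partial_division_of {\<alpha>..\<beta>}"
        by (rule tagged_partial_division_subset[OF _ badp]) (use p in \<open>simp add: tagged_division_of_def\<close>)
      have K: "{Inf K..Sup K} = K \<and> Inf K \<le> x \<and> x \<le> Sup K \<and> \<alpha> \<le> Inf K \<and> Sup K \<le> \<beta> \<and> measure lborel K = Sup K - Inf K"
        if xp: "(x, K) \<in> p" for x K
      proof -
        obtain a b where ab: "K = cbox a b" using tagged_division_ofD(4)[OF p xp] by blast
        have "x \<in> K" using tagged_division_ofD(2)[OF p xp] .
        moreover have "K \<subseteq> {\<alpha>..\<beta>}" using tagged_division_ofD(3)[OF p xp] .
        ultimately show ?thesis using ab by (auto simp: cbox_interval)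
      qed
      have eq: "(\<Sum>(x, K)\<in>p. measure lborel K *\<^sub>R f x) - (\<gamma> \<beta> - \<gamma> \<alpha>)
          = (\<Sum>(x, K)\<in>p. measure lborel K *\<^sub>R f x - (\<gamma> (Sup K) - \<gamma> (Inf K)))"
        by (simp add: additive_tagged_division_1[OF \<open>\<alpha> \<le> \<beta>\<close> p, of \<gamma>, symmetric] sum_subtractf case_prod_unfold)
      define F where "F = (\<lambda>(x, K). norm (measure lborel K *\<^sub>R f x - (\<gamma> (Sup K) - \<gamma> (Inf K))))"
      have good: "F xK \<le> c * (case xK of (x, K) \<Rightarrow> Sup K - Inf K)" if "xK \<in> p - bad" for xK
      proof -
        obtain x K where xK: "xK = (x, K)" by force
        have xp: "(x, K) \<in> p" "x \<notin> S" using that xK by (auto simp: bad_def)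
        note k = K[OF xp(1)]
        define u v where "u = Inf K" and "v = Sup K"
        have uv: "K = {u..v}" "u \<le> x" "x \<le> v" "\<alpha> \<le> u" "v \<le> \<beta>" "measure lborel K = v - u"
          using k unfolding u_def v_def by auto
        have xs: "x \<in> {\<alpha>..\<beta>} - S" using uv xp by auto
        have "K \<subseteq> G x" using fine xp(1) by (auto simp: fine_def)
        then have kb: "K \<subseteq> ball x (d x)" using xs by (auto simp: G_def)
        have nu: "norm (u - x) < d x" and nv: "norm (v - x) < d x"
          using subsetD[OF kb, of u] subsetD[OF kb, of v] uv by (auto simp: dist_norm norm_minus_commute)
        \<comment> \<open>The tag lies between \<open>u\<close> and \<open>v\<close>, so the error
          splits at \<open>x\<close>, and the two distances \<open>x - u\<close> and
          \<open>v - x\<close> add up to \<open>v - u\<close>.\<close>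
        have "F xK = norm ((\<gamma> u - \<gamma> x - (u - x) *\<^sub>R \<gamma>' x) - (\<gamma> v - \<gamma> x - (v - x) *\<^sub>R \<gamma>' x))"
          using xp(2) unfolding F_def xK prod.case uv(6) u_def[symmetric] v_def[symmetric] by (simp add: f_def algebra_simps)
        also have "\<dots> \<le> norm (\<gamma> u - \<gamma> x - (u - x) *\<^sub>R \<gamma>' x) + norm (\<gamma> v - \<gamma> x - (v - x) *\<^sub>R \<gamma>' x)"
          by (rule norm_triangle_ineq4)
        also have "\<dots> \<le> c * norm (u - x) + c * norm (v - x)"
          by (intro add_mono d(2) xs nu nv) (use uv in auto)
        also have "\<dots> = c * (v - u)" using uv by (simp add: algebra_simps)
        finally show ?thesis by (simp add: xK u_def v_def)
      qed
      have tot: "(\<Sum>(x, K)\<in>p. Sup K - Inf K) = \<beta> - \<alpha>"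
        using additive_tagged_division_1[OF \<open>\<alpha> \<le> \<beta>\<close> p, of "\<lambda>x. x"] by simp
      have "sum F (p - bad) \<le> (\<Sum>xK\<in>p - bad. c * (case xK of (x, K) \<Rightarrow> Sup K - Inf K))"
        by (rule sum_mono) (use good in auto)
      also have "\<dots> \<le> (\<Sum>xK\<in>p. c * (case xK of (x, K) \<Rightarrow> Sup K - Inf K))"
        by (rule sum_mono2[OF finp]) (auto dest!: K intro!: mult_nonneg_nonneg less_imp_le[OF c(1)])
      also have "\<dots> = c * (\<beta> - \<alpha>)" by (simp add: sum_distrib_left[symmetric] tot)
      finally have 1: "sum F (p - bad) < e / 2" using c(2) by linarith
      define q where "q = {(x, K) \<in> bad. Inf K < Sup K}"
      define D where "D = (\<lambda>(x, K). (Inf K, Sup K)) ` q"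
      note D = tagged_partial_division_reindex_endpoints[OF bp, folded q_def, folded D_def]
      have DU: "{u<..<v} \<subseteq> U" if "(u, v) \<in> D" for u v
      proof -
        obtain x K where xK: "(x, K) \<in> bad" "u = Inf K" "v = Sup K" using \<open>(u, v) \<in> D\<close> by (auto simp: D_def q_def)
        have "K \<subseteq> G x" using fine xK(1) badp by (auto simp: fine_def)
        then have "K \<subseteq> U" using xK by (auto simp: G_def bad_def)
        moreover have "{u<..<v} \<subseteq> K" using K[of x K] xK badp by (metis greaterThanLessThan_subseteq_atLeastAtMost_iff order_refl subsetD)
        ultimately show ?thesis by blast
      qed
      \<comment> \<open>The intervals are disjoint and contained in \<open>U\<close>, so their total
        length is less than \<open>\<delta>\<close>.\<close>
      have "(\<Sum>(u, v)\<in>D. v - u) = (\<Sum>uv\<in>D. measure lebesgue (case uv of (u, v) \<Rightarrow> {u<..<v}))"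
        by (rule sum.cong) (use D(2) in auto)
      also have "\<dots> = measure lebesgue (\<Union>uv\<in>D. case uv of (u, v) \<Rightarrow> {u<..<v})"
        by (rule measure_finite_Union[symmetric, OF D(1) _ D(3)]) (use D(2) in auto)
      also have "\<dots> \<le> measure lebesgue U"
        by (rule measure_mono_fmeasurable[OF _ _ Um]) (use DU D(1) in auto)
      finally have "(\<Sum>(u, v)\<in>D. v - u) < \<delta>" using Ud by linarith
      then have "(\<Sum>(u, v)\<in>D. norm (\<gamma> v - \<gamma> u)) < e / 2" by (rule small[OF D(1-3)])
      also have "(\<Sum>(u, v)\<in>D. norm (\<gamma> v - \<gamma> u)) = (\<Sum>(x, K)\<in>q. norm (\<gamma> (Sup K) - \<gamma> (Inf K)))"
        by (rule D(4))
      also have "\<dots> = sum F q"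
        by (rule sum.cong) (auto simp: F_def f_def q_def bad_def norm_minus_commute)
      \<comment> \<open>The omitted degenerate intervals have length 0 and increment 0.\<close>
      also have "\<dots> = sum F bad"
      proof (rule sum.mono_neutral_left)
        show "finite bad" using finp badp finite_subset by blast
        show "\<forall>xK\<in>bad - q. F xK = 0"
        proof
          fix xK assume *: "xK \<in> bad - q"
          obtain x K where xK: "xK = (x, K)" by force
          have "(x, K) \<in> p" "x \<in> S" "\<not> Inf K < Sup K" using * xK by (auto simp: bad_def q_def)
          moreover from this have "Inf K = Sup K" using K[of x K] by linarith
          ultimately show "F xK = 0" using K[of x K] by (simp add: F_def xK f_def)
        qed
      qed (auto simp: q_def)
      finally have 2: "sum F bad < e / 2" .
      have "norm (\<Sum>(x, K)\<in>p. measure lborel K *\<^sub>R f x - (\<gamma> (Sup K) - \<gamma> (Inf K))) \<le> sum F p"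
        unfolding F_def by (rule order.trans[OF norm_sum]) (simp add: case_prod_unfold)
      also have "\<dots> = sum F (p - bad) + sum F bad"
        by (rule sum.subset_diff[OF badp finp])
      finally show "norm ((\<Sum>(x, K)\<in>p. measure lborel K *\<^sub>R f x) - (\<gamma> \<beta> - \<gamma> \<alpha>)) < e"
        using 1 2 unfolding eq by linarith
    qed
  qed
  then show ?thesis
    by (rule has_integral_spike[OF S, rotated]) (auto simp: f_def)
qed

lemma abs_continuous_curve_subinterval:
  assumes "abs_continuous_curve \<alpha> \<beta> \<gamma>" "\<alpha> \<le> u" "v \<le> \<beta>"
  shows "abs_continuous_curve u v \<gamma>"
  unfolding abs_continuous_curve_def
proof (intro allI impI)
  fix e :: real assume "e > 0"
  then obtain \<delta> where \<delta>: "\<delta> > 0" and small: "\<And>D. \<lbrakk>finite D; \<forall>(u, v)\<in>D. \<alpha> \<le> u \<and> u < v \<and> v \<le> \<beta>;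
      disjoint_family_on (\<lambda>(u, v). {u<..<v}) D; (\<Sum>(u, v)\<in>D. v - u) < \<delta>\<rbrakk>
      \<Longrightarrow> (\<Sum>(u, v)\<in>D. norm (\<gamma> v - \<gamma> u)) < e"
    using assms(1) unfolding abs_continuous_curve_def by meson
  show "\<exists>\<delta>>0. \<forall>D. finite D \<longrightarrow> (\<forall>(a, b)\<in>D. u \<le> a \<and> a < b \<and> b \<le> v) \<longrightarrow>
      disjoint_family_on (\<lambda>(u, v). {u<..<v}) D \<longrightarrow> (\<Sum>(u, v)\<in>D. v - u) < \<delta> \<longrightarrow>
      (\<Sum>(u, v)\<in>D. norm (\<gamma> v - \<gamma> u)) < e"
  proof (intro exI[of _ \<delta>] conjI \<delta> allI impI)
    fix D assume D: "finite D" "\<forall>(a, b)\<in>D. u \<le> a \<and> a < b \<and> b \<le> v"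
      "disjoint_family_on (\<lambda>(u, v). {u<..<v}) D" "(\<Sum>(u, v)\<in>D. v - u) < \<delta>"
    have "\<forall>(a, b)\<in>D. \<alpha> \<le> a \<and> a < b \<and> b \<le> \<beta>" using D(2) assms(2,3) by auto
    then show "(\<Sum>(u, v)\<in>D. norm (\<gamma> v - \<gamma> u)) < e" using small D by blast
  qed
qed

text \<open>Applied with \<open>\<gamma>\<close> the identity to obtain smooth curves, and with an
  affine map after \<open>\<gamma>\<close> for left translations.\<close>

lemma abs_continuous_curve_lipschitz_image:
  assumes "abs_continuous_curve \<alpha> \<beta> \<gamma>" "B > 0"
    and lip: "\<And>u v. \<alpha> \<le> u \<Longrightarrow> u < v \<Longrightarrow> v \<le> \<beta> \<Longrightarrow> norm (\<eta> v - \<eta> u) \<le> B * norm (\<gamma> v - \<gamma> u)"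
  shows "abs_continuous_curve \<alpha> \<beta> \<eta>"
  unfolding abs_continuous_curve_def
proof (intro allI impI)
  fix e :: real assume "e > 0"
  then have "e / B > 0" using \<open>B > 0\<close> by simp
  then obtain \<delta> where \<delta>: "\<delta> > 0" and small: "\<And>D. \<lbrakk>finite D; \<forall>(u, v)\<in>D. \<alpha> \<le> u \<and> u < v \<and> v \<le> \<beta>;
      disjoint_family_on (\<lambda>(u, v). {u<..<v}) D; (\<Sum>(u, v)\<in>D. v - u) < \<delta>\<rbrakk>
      \<Longrightarrow> (\<Sum>(u, v)\<in>D. norm (\<gamma> v - \<gamma> u)) < e / B"
    using assms(1) unfolding abs_continuous_curve_def by meson
  show "\<exists>\<delta>>0. \<forall>D. finite D \<longrightarrow> (\<forall>(u, v)\<in>D. \<alpha> \<le> u \<and> u < v \<and> v \<le> \<beta>) \<longrightarrow>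
      disjoint_family_on (\<lambda>(u, v). {u<..<v}) D \<longrightarrow> (\<Sum>(u, v)\<in>D. v - u) < \<delta> \<longrightarrow>
      (\<Sum>(u, v)\<in>D. norm (\<eta> v - \<eta> u)) < e"
  proof (intro exI[of _ \<delta>] conjI \<delta> allI impI)
    fix D assume D: "finite D" "\<forall>(u, v)\<in>D. \<alpha> \<le> u \<and> u < v \<and> v \<le> \<beta>"
      "disjoint_family_on (\<lambda>(u, v). {u<..<v}) D" "(\<Sum>(u, v)\<in>D. v - u) < \<delta>"
    have "(\<Sum>(u, v)\<in>D. norm (\<eta> v - \<eta> u)) \<le> (\<Sum>(u, v)\<in>D. B * norm (\<gamma> v - \<gamma> u))"
      by (rule sum_mono) (use D(2) lip in fastforce)
    also have "\<dots> = B * (\<Sum>(u, v)\<in>D. norm (\<gamma> v - \<gamma> u))"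
      by (simp add: sum_distrib_left case_prod_unfold)
    also have "\<dots> < B * (e / B)" by (intro mult_strict_left_mono small D \<open>B > 0\<close>)
    finally show "(\<Sum>(u, v)\<in>D. norm (\<eta> v - \<eta> u)) < e" using \<open>B > 0\<close> by simp
  qed
qed

lemma abs_continuous_curve_id: "abs_continuous_curve \<alpha> \<beta> (\<lambda>s::real. s)"
  unfolding abs_continuous_curve_def
proof (intro allI impI)
  fix e :: real assume e: "e > 0"
  have "(\<Sum>(u, v)\<in>D. norm (v - u)) = (\<Sum>(u, v)\<in>D. v - u)" if "\<forall>(u, v)\<in>D. \<alpha> \<le> u \<and> u < v \<and> v \<le> \<beta>" for D
    by (rule sum.cong) (use that in auto)
  then show "\<exists>\<delta>>0. \<forall>D. finite D \<longrightarrow> (\<forall>(u, v)\<in>D. \<alpha> \<le> u \<and> u < v \<and> v \<le> \<beta>) \<longrightarrow>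
      disjoint_family_on (\<lambda>(u, v). {u<..<v}) D \<longrightarrow> (\<Sum>(u, v)\<in>D. v - u) < \<delta> \<longrightarrow>
      (\<Sum>(u, v)\<in>D. norm (v - u)) < e"
    using e by auto
qed

lemma abs_continuous_curve_C1:
  fixes \<gamma> :: "real \<Rightarrow> 'a::euclidean_space"
  assumes deriv: "\<And>s. s \<in> {\<alpha>..\<beta>} \<Longrightarrow> (\<gamma> has_vector_derivative \<gamma>' s) (at s within {\<alpha>..\<beta>})"
    and cont: "continuous_on {\<alpha>..\<beta>} \<gamma>'"
  shows "abs_continuous_curve \<alpha> \<beta> \<gamma>"
proof -
  have "bounded (\<gamma>' ` {\<alpha>..\<beta>})" by (intro compact_imp_bounded compact_continuous_image cont) auto
  then obtain B where B: "B > 0" "\<And>s. s \<in> {\<alpha>..\<beta>} \<Longrightarrow> norm (\<gamma>' s) \<le> B"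
    unfolding bounded_pos by auto
  show ?thesis
  proof (rule abs_continuous_curve_lipschitz_image[OF abs_continuous_curve_id B(1)])
    fix u v assume uv: "\<alpha> \<le> u" "u < v" "v \<le> \<beta>"
    have "(\<gamma>' has_integral (\<gamma> v - \<gamma> u)) {u..v}"
      by (rule fundamental_theorem_of_calculus)
        (use uv in \<open>auto intro: has_vector_derivative_within_subset[OF deriv]\<close>)
    then have "norm (\<gamma> v - \<gamma> u) \<le> B * measure lborel {u..v}"
      unfolding box_real(2)[symmetric] by (rule has_integral_bound[rotated]) (use uv B in auto)
    then show "norm (\<gamma> v - \<gamma> u) \<le> B * norm (v - u)" using uv by simp
  qed
qed

section \<open>The isoperimetric lower bound for the length\<close>

lemma mult_cos_le_sin:
  fixes \<phi> :: real
  assumes "0 \<le> \<phi>" "\<phi> \<le> pi"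
  shows "\<phi> * cos \<phi> \<le> sin \<phi>"
proof -
  have "(\<lambda>u. sin u - u * cos u) 0 \<le> (\<lambda>u. sin u - u * cos u) \<phi>"
  proof (rule DERIV_nonneg_imp_nondecreasing[OF assms(1)])
    fix u assume u: "0 \<le> u" "u \<le> \<phi>"
    have "((\<lambda>u. sin u - u * cos u) has_real_derivative u * sin u) (at u)"
      by (auto intro!: derivative_eq_intros)
    moreover have "u * sin u \<ge> 0" using u assms by (simp add: sin_ge_zero)
    ultimately show "\<exists>d. ((\<lambda>u. sin u - u * cos u) has_real_derivative d) (at u) \<and> 0 \<le> d" by blast
  qed
  then show ?thesis by simp
qed

text \<open>As a function of \<open>(x, y)\<close> the difference of the two sides is a concave quadratic polynomial; its
  maximum is \<open>r (\<phi> cot \<phi> - 1)\<close> with \<open>\<phi> = \<omega> r\<close>.\<close>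
lemma cot_semigroup_step:
  fixes x y t p q A \<omega> :: real
  defines "r \<equiv> sqrt (p\<^sup>2 + q\<^sup>2)"
  assumes "\<omega> > 0" "A > 0" "r > 0" "A + \<omega> * r < pi"
  shows "\<omega> * (t + 2 * (p * y - q * x)) + ((x + p)\<^sup>2 + (y + q)\<^sup>2) * \<omega> * cot (A + \<omega> * r)
    \<le> \<omega> * t + (x\<^sup>2 + y\<^sup>2) * \<omega> * cot A + r"
proof -
  define \<phi> B where "\<phi> = \<omega> * r" and "B = A + \<omega> * r"
  have rng: "0 < \<phi>" "\<phi> < pi" "0 < B" "B < pi" "A < pi" "A = B - \<phi>"
    using assms(2-) mult_pos_pos[OF assms(2,4)] unfolding \<phi>_def B_def by linarith+
  have s: "sin \<phi> > 0" "sin A > 0" "sin B > 0"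
    using rng \<open>A > 0\<close> by (auto intro!: sin_gt_zero)
  \<comment> \<open>\<open>k\<close> turns out to be \<open>cot A - cot B\<close>, the coefficient
    of \<open>-(x^2 + y^2)\<close> in the quadratic polynomial, up to the factor
    \<open>\<omega>\<close>.\<close>
  define k where "k = sin \<phi> / (sin A * sin B)"
  have k: "k > 0" using s by (simp add: k_def)
  have "sin \<phi> = sin B * cos A - cos B * sin A" using rng(6) by (simp add: sin_diff[symmetric])
  then have cot: "cot A - cot B = k" using s by (simp add: k_def cot_def field_simps)
  have l2: "p\<^sup>2 + q\<^sup>2 = r\<^sup>2" unfolding r_def by simp
  \<comment> \<open>Half the coefficients of the linear terms in \<open>x\<close> and
    \<open>y\<close>, again up to the factor \<open>\<omega>\<close>.\<close>
  define u v where "u = p * cot B - q" and "v = q * cot B + p"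
  have "1 + (cot B)\<^sup>2 = 1 / (sin B)\<^sup>2"
    using s sin_cos_squared_add[of B] by (simp add: cot_def power_divide field_simps)
  moreover have "u\<^sup>2 + v\<^sup>2 = (p\<^sup>2 + q\<^sup>2) * (1 + (cot B)\<^sup>2)"
    by (simp add: u_def v_def power2_eq_square algebra_simps)
  ultimately have uv: "u\<^sup>2 + v\<^sup>2 = r\<^sup>2 / (sin B)\<^sup>2" by (simp add: l2)
  have sq: "2 * (x * u + y * v) - k * (x\<^sup>2 + y\<^sup>2) \<le> (u\<^sup>2 + v\<^sup>2) / k"
  proof -
    have "(u\<^sup>2 + v\<^sup>2) / k - (2 * (x * u + y * v) - k * (x\<^sup>2 + y\<^sup>2)) = ((k * x - u)\<^sup>2 + (k * y - v)\<^sup>2) / k"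
      using k by (simp add: field_simps power2_eq_square)
    also have "\<dots> \<ge> 0" using k by simp
    finally show ?thesis by simp
  qed
  \<comment> \<open>With \<open>sin A = sin (B - \<phi>)\<close> the maximal value of the quadratic
    polynomial simplifies to \<open>r^2 * cot \<phi>\<close>, independently of
    \<open>A\<close>.\<close>
  have "sin A = sin B * cos \<phi> - cos B * sin \<phi>" using rng(6) by (simp add: sin_diff)
  then have "sin A / (sin B * sin \<phi>) + cot B = cos \<phi> / sin \<phi>"
    using s by (simp add: cot_def field_simps)
  moreover have "(u\<^sup>2 + v\<^sup>2) / k = r\<^sup>2 * (sin A / (sin B * sin \<phi>))"
    using s unfolding uv k_def by (simp add: field_simps power2_eq_square)
  ultimately have fin: "(u\<^sup>2 + v\<^sup>2) / k + r\<^sup>2 * cot B = r\<^sup>2 * (cos \<phi> / sin \<phi>)"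
    by (metis distrib_left)
  have "\<omega> * (t + 2 * (p * y - q * x)) + ((x + p)\<^sup>2 + (y + q)\<^sup>2) * \<omega> * cot B
      - (\<omega> * t + (x\<^sup>2 + y\<^sup>2) * \<omega> * cot A)
    = \<omega> * (2 * (x * u + y * v) - (cot A - cot B) * (x\<^sup>2 + y\<^sup>2) + (p\<^sup>2 + q\<^sup>2) * cot B)"
    by (simp add: u_def v_def power2_eq_square algebra_simps)
  also have "\<dots> \<le> \<omega> * (r\<^sup>2 * (cos \<phi> / sin \<phi>))"
    unfolding cot l2 using sq fin \<open>\<omega> > 0\<close> by (intro mult_left_mono) auto
  also have "\<dots> = r * (\<phi> * cos \<phi> / sin \<phi>)"
    by (simp add: \<phi>_def power2_eq_square)
  also have "\<dots> \<le> r * 1"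
    using mult_cos_le_sin[of \<phi>] rng s \<open>r > 0\<close> by (intro mult_left_mono) (auto simp: field_simps)
  finally show ?thesis by (simp add: B_def)
qed

text \<open>Here \<open>\<tau> n\<close> is the height of the horizontal lift of the polygon. With a
  fixed curvature \<open>\<omega>\<close>, the angle after \<open>n\<close> edges is
  \<open>\<omega> * len n\<close>, and \<open>cot_semigroup_step\<close> carries the bound across
  one more edge. Only at the end is \<open>\<omega>\<close> chosen so that the final angle is
  \<open>\<theta>\<close>.\<close>

lemma polygon_isoperimetric:
  fixes x y :: "nat \<Rightarrow> real" and \<theta> :: real
  defines "len \<equiv> \<lambda>n. \<Sum>i<n. sqrt ((x (Suc i) - x i)\<^sup>2 + (y (Suc i) - y i)\<^sup>2)"
  defines "\<tau> \<equiv> \<lambda>n. \<Sum>i<n. 2 * ((x (Suc i) - x i) * y i - (y (Suc i) - y i) * x i)"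
  assumes start: "x 0 = 0" "y 0 = 0" and \<theta>: "0 < \<theta>" "\<theta> < pi"
  shows "\<theta> * \<tau> n + \<theta> * cot \<theta> * ((x n)\<^sup>2 + (y n)\<^sup>2) \<le> (len n)\<^sup>2"
proof -
  have nonneg: "len n \<ge> 0" for n by (auto simp: len_def intro!: sum_nonneg)
  \<comment> \<open>Length 0 is recorded separately since the cotangent is singular at angle 0; such
    a polygon has not left the origin.\<close>
  have *: "(len n = 0 \<longrightarrow> x n = 0 \<and> y n = 0 \<and> \<tau> n = 0) \<and>
     (len n > 0 \<longrightarrow> \<omega> * \<tau> n + ((x n)\<^sup>2 + (y n)\<^sup>2) * \<omega> * cot (\<omega> * len n) \<le> len n)"
    if "\<omega> * len n < pi" "\<omega> > 0" for n \<omega>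
    using that(1)
  proof (induction n)
    case 0
    then show ?case by (simp add: len_def \<tau>_def start)
  next
    case (Suc n)
    define p q where "p = x (Suc n) - x n" and "q = y (Suc n) - y n"
    define s where "s = sqrt (p\<^sup>2 + q\<^sup>2)"
    have s0: "s \<ge> 0" by (simp add: s_def)
    have l: "len (Suc n) = len n + s" by (simp add: len_def s_def p_def q_def)
    have t: "\<tau> (Suc n) = \<tau> n + 2 * (p * y n - q * x n)" by (simp add: \<tau>_def p_def q_def)
    have xy: "x (Suc n) = x n + p" "y (Suc n) = y n + q" by (auto simp: p_def q_def)
    have "\<omega> * len n \<le> \<omega> * len (Suc n)" using l s0 \<open>\<omega> > 0\<close> by simp
    then have IH: "len n = 0 \<Longrightarrow> x n = 0 \<and> y n = 0 \<and> \<tau> n = 0"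
       "len n > 0 \<Longrightarrow> \<omega> * \<tau> n + ((x n)\<^sup>2 + (y n)\<^sup>2) * \<omega> * cot (\<omega> * len n) \<le> len n"
      using Suc by auto
    consider "s = 0" | "s > 0" "len n = 0" | "s > 0" "len n > 0"
      using s0 nonneg[of n] by linarith
    then show ?case
    proof cases
      case 1
      then have "p = 0" "q = 0" by (auto simp: s_def sum_power2_eq_zero_iff)
      then show ?thesis using IH nonneg[of n] by (auto simp: l 1 t xy)
    next
      \<comment> \<open>The first nondegenerate edge starts at angle 0, where
        \<open>cot_semigroup_step\<close> does not apply; the bound reduces to
        \<open>\<phi> * cot \<phi> \<le> 1\<close> with
        \<open>\<phi> = \<omega> * s\<close>.\<close>
      case 2
      then have z: "x n = 0" "y n = 0" "\<tau> n = 0" using IH by auto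
      have r: "0 < \<omega> * s" "\<omega> * s < pi" using 2 Suc.prems \<open>\<omega> > 0\<close> by (auto simp: l)
      have sp: "sin (\<omega> * s) > 0" by (rule sin_gt_zero[OF r])
      have "(p\<^sup>2 + q\<^sup>2) * \<omega> * cot (\<omega> * s) = s * ((\<omega> * s) * cos (\<omega> * s) / sin (\<omega> * s))"
        by (simp add: s_def cot_def power2_eq_square[symmetric])
      also have "\<dots> \<le> s * 1"
        using mult_cos_le_sin[of "\<omega> * s"] r sp \<open>s > 0\<close> by (intro mult_left_mono) (auto simp: field_simps)
      finally show ?thesis using 2 by (simp add: l t xy z)
    next
      case 3
      have "\<omega> * (\<tau> n + 2 * (p * y n - q * x n)) + ((x n + p)\<^sup>2 + (y n + q)\<^sup>2) * \<omega> * cot (\<omega> * len n + \<omega> * s)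
        \<le> \<omega> * \<tau> n + ((x n)\<^sup>2 + (y n)\<^sup>2) * \<omega> * cot (\<omega> * len n) + s"
        unfolding s_def by (rule cot_semigroup_step)
          (use 3 Suc.prems \<open>\<omega> > 0\<close> in \<open>auto simp: s_def[symmetric] l algebra_simps\<close>)
      then show ?thesis using 3 IH by (simp add: l t xy algebra_simps)
    qed
  qed
  show ?thesis
  proof (cases "len n = 0")
    case True
    then show ?thesis using *[of 1 n] by simp
  next
    case False
    then have pos: "len n > 0" using nonneg[of n] by linarith
    \<comment> \<open>The choice \<open>\<omega> = \<theta> / len n\<close>; multiplying by
      \<open>len n\<close> gives the claim.\<close>
    have "\<theta> / len n * \<tau> n + ((x n)\<^sup>2 + (y n)\<^sup>2) * (\<theta> / len n) * cot (\<theta> / len n * len n) \<le> len n"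
      using *[of "\<theta> / len n" n] pos \<theta> by simp
    then have "(\<theta> * \<tau> n + \<theta> * cot \<theta> * ((x n)\<^sup>2 + (y n)\<^sup>2)) / len n \<le> len n"
      using pos by (simp add: add_divide_distrib mult.commute mult.left_commute)
    then show ?thesis using pos by (simp add: pos_divide_le_eq power2_eq_square)
  qed
qed

text \<open>Inscribed polygons are not longer than the curve, and their heights converge to that of the curve.\<close>
lemma horizontal_path_isoperimetric:
  fixes x y t a b :: "real \<Rightarrow> real" and \<theta> :: real
  assumes "\<alpha> < \<beta>"
    and a: "\<And>u v. \<alpha> \<le> u \<Longrightarrow> u \<le> v \<Longrightarrow> v \<le> \<beta> \<Longrightarrow> (a has_integral x v - x u) {u..v}"
    and b: "\<And>u v. \<alpha> \<le> u \<Longrightarrow> u \<le> v \<Longrightarrow> v \<le> \<beta> \<Longrightarrow> (b has_integral y v - y u) {u..v}"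
    and t: "\<And>u v. \<alpha> \<le> u \<Longrightarrow> u \<le> v \<Longrightarrow> v \<le> \<beta> \<Longrightarrow>
       ((\<lambda>s. 2 * (a s * y s - b s * x s)) has_integral t v - t u) {u..v}"
    and L: "((\<lambda>s. sqrt ((a s)\<^sup>2 + (b s)\<^sup>2)) has_integral L) {\<alpha>..\<beta>}"
    and cont: "continuous_on {\<alpha>..\<beta>} x" "continuous_on {\<alpha>..\<beta>} y"
    and start: "x \<alpha> = 0" "y \<alpha> = 0" "t \<alpha> = 0" and \<theta>: "0 < \<theta>" "\<theta> < pi"
  shows "\<theta> * t \<beta> + \<theta> * cot \<theta> * ((x \<beta>)\<^sup>2 + (y \<beta>)\<^sup>2) \<le> L\<^sup>2"
proof -
  define \<sigma> where "\<sigma> s = sqrt ((a s)\<^sup>2 + (b s)\<^sup>2)" for s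
  have \<sigma>0: "\<sigma> s \<ge> 0" and \<sigma>a: "\<bar>a s\<bar> \<le> \<sigma> s" and \<sigma>b: "\<bar>b s\<bar> \<le> \<sigma> s" for s
    by (auto simp: \<sigma>_def real_le_rsqrt)
  have \<sigma>int: "\<sigma> integrable_on {u..v}" if "\<alpha> \<le> u" "v \<le> \<beta>" for u v
    by (rule integrable_subinterval_real[of _ \<alpha> \<beta>]) (use L that in \<open>auto simp: \<sigma>_def[abs_def]\<close>)
  have L': "integral {\<alpha>..\<beta>} \<sigma> = L" using L unfolding \<sigma>_def[abs_def] by (rule integral_unique)
  have L0: "L \<ge> 0" using integral_nonneg[OF \<sigma>int[OF order.refl order.refl]] \<sigma>0 L' by auto
  have chord: "sqrt ((x v - x u)\<^sup>2 + (y v - y u)\<^sup>2) \<le> integral {u..v} \<sigma>"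
    if uv: "\<alpha> \<le> u" "u \<le> v" "v \<le> \<beta>" for u v
  proof -
    have "((\<lambda>s. (a s, b s)) has_integral (x v - x u, y v - y u)) {u..v}"
      by (rule has_integral_componentwise) (use a[OF uv] b[OF uv] in \<open>auto simp: Basis_prod_def\<close>)
    then have "norm (x v - x u, y v - y u) \<le> integral {u..v} \<sigma>"
      using integral_norm_bound_integral[of "\<lambda>s. (a s, b s)" "{u..v}" \<sigma>] \<sigma>int[OF uv(1,3)]
      by (auto simp: \<sigma>_def norm_Pair has_integral_iff)
    then show ?thesis by (simp add: norm_Pair)
  qed
  \<comment> \<open>The height gained along the curve differs from that of the lifted chord by twice
    the integral of \<open>a (y - y u) - b (x - x u)\<close>; each of the two products is at most
    the oscillation \<open>\<eta>\<close> times the speed.\<close>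
  have area: "\<bar>t v - t u - 2 * ((x v - x u) * y u - (y v - y u) * x u)\<bar> \<le> 4 * \<eta> * integral {u..v} \<sigma>"
    if uv: "\<alpha> \<le> u" "u \<le> v" "v \<le> \<beta>"
      and \<eta>: "\<And>s. s \<in> {u..v} \<Longrightarrow> \<bar>x s - x u\<bar> \<le> \<eta> \<and> \<bar>y s - y u\<bar> \<le> \<eta>" for u v \<eta>
  proof -
    define g where "g s = 2 * (a s * (y s - y u) - b s * (x s - x u))" for s
    have "((\<lambda>s. 2 * (a s * y s - b s * x s) - 2 * (a s * y u - b s * x u)) has_integral
        (t v - t u - 2 * ((x v - x u) * y u - (y v - y u) * x u))) {u..v}"
      by (intro has_integral_diff t has_integral_mult_right has_integral_mult_left a b uv)
    moreover have "(\<lambda>s. 2 * (a s * y s - b s * x s) - 2 * (a s * y u - b s * x u)) = g"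
      by (simp add: g_def fun_eq_iff algebra_simps)
    ultimately have g: "(g has_integral (t v - t u - 2 * ((x v - x u) * y u - (y v - y u) * x u))) {u..v}"
      by simp
    have bound: "norm (g s) \<le> 4 * \<eta> * \<sigma> s" if "s \<in> {u..v}" for s
    proof -
      have "\<bar>a s * (y s - y u)\<bar> \<le> \<sigma> s * \<eta>" "\<bar>b s * (x s - x u)\<bar> \<le> \<sigma> s * \<eta>"
        unfolding abs_mult using \<eta>[OF that] \<sigma>a \<sigma>b \<sigma>0 by (auto intro!: mult_mono)
      then show ?thesis unfolding g_def by (simp add: algebra_simps)
    qed
    have "(\<lambda>s. 4 * \<eta> * \<sigma> s) integrable_on {u..v}"
      using integrable_on_mult_right[OF \<sigma>int[OF uv(1,3)]] by simp
    then have "norm (integral {u..v} g) \<le> integral {u..v} (\<lambda>s. 4 * \<eta> * \<sigma> s)"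
      using integral_norm_bound_integral[of g "{u..v}"] g bound by blast
    then show ?thesis using g by (simp add: integral_unique)
  qed
  have approx: "\<theta> * t \<beta> + \<theta> * cot \<theta> * ((x \<beta>)\<^sup>2 + (y \<beta>)\<^sup>2) \<le> L\<^sup>2 + \<theta> * (4 * \<eta> * L)" if "\<eta> > 0" for \<eta>
  proof -
    have unif: "\<exists>d>0. \<forall>s\<in>{\<alpha>..\<beta>}. \<forall>s'\<in>{\<alpha>..\<beta>}. \<bar>s' - s\<bar> < d \<longrightarrow> \<bar>f s' - f s\<bar> < \<eta>"
      if "continuous_on {\<alpha>..\<beta>} f" for f :: "real \<Rightarrow> real"
      using compact_uniformly_continuous[OF that compact_Icc] \<open>\<eta> > 0\<close>
      unfolding uniformly_continuous_on_def dist_real_def by blast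
    obtain d1 where d1: "d1 > 0" "\<And>s s'. s \<in> {\<alpha>..\<beta>} \<Longrightarrow> s' \<in> {\<alpha>..\<beta>} \<Longrightarrow> \<bar>s' - s\<bar> < d1 \<Longrightarrow> \<bar>x s' - x s\<bar> < \<eta>"
      using unif[OF cont(1)] by blast
    obtain d2 where d2: "d2 > 0" "\<And>s s'. s \<in> {\<alpha>..\<beta>} \<Longrightarrow> s' \<in> {\<alpha>..\<beta>} \<Longrightarrow> \<bar>s' - s\<bar> < d2 \<Longrightarrow> \<bar>y s' - y s\<bar> < \<eta>"
      using unif[OF cont(2)] by blast
    obtain n :: nat where n: "(\<beta> - \<alpha>) / min d1 d2 < real n" using reals_Archimedean2 by blast
    have n0: "real n > 0" using n d1(1) d2(1) \<open>\<alpha> < \<beta>\<close>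
      by (metis diff_gt_0_iff_gt divide_pos_pos less_trans min_less_iff_conj)
    define h where "h = (\<beta> - \<alpha>) / real n"
    have h: "h > 0" "h < d1" "h < d2" "real n * h = \<beta> - \<alpha>"
      using n n0 d1(1) d2(1) \<open>\<alpha> < \<beta>\<close> by (auto simp: h_def field_simps min_def split: if_splits intro: less_le_trans)
    define s where "s i = \<alpha> + real i * h" for i
    have s: "s 0 = \<alpha>" "s n = \<beta>" "\<And>i. s (Suc i) = s i + h" "\<And>i. \<alpha> \<le> s i"
      using h by (auto simp: s_def algebra_simps)
    have sn: "s i \<le> \<beta>" if "i \<le> n" for i
      using mult_right_mono[of "real i" "real n" h] h that by (simp add: s_def)
    have tele: "(\<Sum>i<k. integral {s i..s (Suc i)} \<sigma>) = integral {\<alpha>..s k} \<sigma>" if "k \<le> n" for k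
      using that
    proof (induction k)
      case (Suc k)
      then show ?case
        using Henstock_Kurzweil_Integration.integral_combine[of \<alpha> "s k" "s (Suc k)" \<sigma>] s(3,4) h(1) \<sigma>int[of \<alpha> "s (Suc k)"] sn[of "Suc k"]
        by auto
    qed (simp add: s)
    define len where "len = (\<Sum>i<n. sqrt ((x (s (Suc i)) - x (s i))\<^sup>2 + (y (s (Suc i)) - y (s i))\<^sup>2))"
    define \<tau> where "\<tau> = (\<Sum>i<n. 2 * ((x (s (Suc i)) - x (s i)) * y (s i) - (y (s (Suc i)) - y (s i)) * x (s i)))"
    have step: "\<alpha> \<le> s i" "s i \<le> s (Suc i)" "s (Suc i) \<le> \<beta>" if "i < n" for i
      using s(3,4) h(1) sn[of "Suc i"] that by auto
    have "len \<le> (\<Sum>i<n. integral {s i..s (Suc i)} \<sigma>)"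
      unfolding len_def by (intro sum_mono chord step) auto
    then have "len \<le> L" using tele[of n] by (simp add: s L')
    moreover have "len \<ge> 0" unfolding len_def by (intro sum_nonneg) auto
    ultimately have len: "len\<^sup>2 \<le> L\<^sup>2" by (rule power_mono)
    have "t (s n) - t (s 0) = (\<Sum>i<n. t (s (Suc i)) - t (s i))"
      by (rule sum_lessThan_telescope[symmetric])
    then have "t \<beta> - \<tau> = (\<Sum>i<n. t (s (Suc i)) - t (s i) -
        2 * ((x (s (Suc i)) - x (s i)) * y (s i) - (y (s (Suc i)) - y (s i)) * x (s i)))"
      by (simp add: s start \<tau>_def sum_subtractf)
    also have "\<dots> \<le> (\<Sum>i<n. 4 * \<eta> * integral {s i..s (Suc i)} \<sigma>)"
    proof (rule sum_mono)
      fix i assume "i \<in> {..<n}"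
      then have i: "i < n" by simp
      have near: "\<bar>x r - x (s i)\<bar> \<le> \<eta> \<and> \<bar>y r - y (s i)\<bar> \<le> \<eta>" if "r \<in> {s i..s (Suc i)}" for r
      proof -
        have "r \<in> {\<alpha>..\<beta>}" "s i \<in> {\<alpha>..\<beta>}" "\<bar>r - s i\<bar> \<le> h"
          using that step[OF i] s(3)[of i] by auto
        then show ?thesis using d1(2)[of "s i" r] d2(2)[of "s i" r] h by auto
      qed
      show "t (s (Suc i)) - t (s i) -
        2 * ((x (s (Suc i)) - x (s i)) * y (s i) - (y (s (Suc i)) - y (s i)) * x (s i))
        \<le> 4 * \<eta> * integral {s i..s (Suc i)} \<sigma>"
        using area[OF step[OF i] near] by linarith
    qed
    also have "\<dots> = 4 * \<eta> * L" using tele[of n] by (simp add: sum_distrib_left[symmetric] s L')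
    finally have "\<theta> * t \<beta> \<le> \<theta> * (\<tau> + 4 * \<eta> * L)" using \<theta>(1) by (intro mult_left_mono) auto
    moreover have "\<theta> * \<tau> + \<theta> * cot \<theta> * ((x (s n))\<^sup>2 + (y (s n))\<^sup>2) \<le> len\<^sup>2"
      unfolding \<tau>_def len_def
      by (rule polygon_isoperimetric[of "\<lambda>i. x (s i)" "\<lambda>i. y (s i)"]) (use s start \<theta> in auto)
    ultimately show ?thesis using len s(2) by (simp add: algebra_simps)
  qed
  show ?thesis
  proof (rule field_le_epsilon)
    fix e :: real assume "e > 0"
    \<comment> \<open>Makes the error \<open>\<theta> * (4 * \<eta> * L)\<close> equal to
      \<open>e * L / (L + 1)\<close>, also when \<open>L = 0\<close>.\<close>
    define \<eta> where "\<eta> = e / (4 * \<theta> * (L + 1))"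
    have "\<eta> > 0" using \<open>e > 0\<close> \<theta> L0 by (simp add: \<eta>_def)
    moreover have "\<theta> * (4 * \<eta> * L) = e * (L / (L + 1))"
      using \<theta> by (simp add: \<eta>_def)
    moreover have "\<dots> \<le> e * 1"
      using \<open>e > 0\<close> L0 by (intro mult_left_mono) auto
    ultimately show "\<theta> * t \<beta> + \<theta> * cot \<theta> * ((x \<beta>)\<^sup>2 + (y \<beta>)\<^sup>2) \<le> L\<^sup>2 + e"
      using approx[of \<eta>] by linarith
  qed
qed

text \<open>By \<open>abs_continuous_has_integral\<close> the coordinates of \<open>\<gamma>\<close>
  are integrals of \<open>a\<close>, \<open>b\<close> and \<open>2 (a y - b x)\<close>, as
  \<open>horizontal_path_isoperimetric\<close> requires. Negative angles reduce to positive ones by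
  the reflection that changes the signs of \<open>y\<close> and \<open>t\<close>.\<close>

lemma horizontal_curve_lower_bound:
  assumes curve: "horizontal_curve \<alpha> \<beta> \<gamma> a b" "\<gamma> \<alpha> = 0" "\<gamma> \<beta> = (X, Y, T)"
    and L: "((\<lambda>s. sqrt ((a s)\<^sup>2 + (b s)\<^sup>2)) has_integral L) {\<alpha>..\<beta>}"
    and \<theta>: "0 < \<bar>\<theta>\<bar>" "\<bar>\<theta>\<bar> < pi"
  shows "\<theta> * T + \<theta> * cot \<theta> * (X\<^sup>2 + Y\<^sup>2) \<le> L\<^sup>2"
proof -
  define x y t where "x s = fst (\<gamma> s)" and "y s = fst (snd (\<gamma> s))" and "t s = snd (snd (\<gamma> s))" for s
  have ab: "\<alpha> < \<beta>" and ac: "abs_continuous_curve \<alpha> \<beta> \<gamma>"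
    using curve(1) by (auto simp: horizontal_curve_def)
  define g where "g s = a s *\<^sub>R heis_X (\<gamma> s) + b s *\<^sub>R heis_Y (\<gamma> s)" for s
  have g: "g s = (a s, b s, 2 * (a s * y s - b s * x s))" for s
    by (cases "\<gamma> s") (auto simp: g_def heis_X_def heis_Y_def x_def y_def)
  have "AE s in lebesgue_on {\<alpha>..\<beta>}. (\<gamma> has_vector_derivative g s) (at s within {\<alpha>..\<beta>})"
    using curve(1) by (simp add: horizontal_curve_def g_def)
  then have "AE s in lebesgue. s \<in> {\<alpha>..\<beta>} \<longrightarrow> (\<gamma> has_vector_derivative g s) (at s within {\<alpha>..\<beta>})"
    by (subst (asm) AE_restrict_space_iff) auto
  then obtain S where N: "\<And>s. s \<in> space lebesgue - S \<Longrightarrow> s \<in> {\<alpha>..\<beta>} \<longrightarrow>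
      (\<gamma> has_vector_derivative g s) (at s within {\<alpha>..\<beta>})" "S \<in> null_sets lebesgue"
    by (rule AE_E3) (rule that)
  have S: "negligible S"
    "\<And>s. s \<in> {\<alpha>..\<beta>} - S \<Longrightarrow> (\<gamma> has_vector_derivative g s) (at s within {\<alpha>..\<beta>})"
    using N by (auto simp: negligible_iff_null_sets)
  have int: "(g has_integral (\<gamma> v - \<gamma> u)) {u..v}" if "\<alpha> \<le> u" "u \<le> v" "v \<le> \<beta>" for u v
    by (rule abs_continuous_has_integral[OF that(2) abs_continuous_curve_subinterval[OF ac] S(1)])
      (use that in \<open>auto intro: has_vector_derivative_within_subset[OF S(2)]\<close>)
  have ix: "(a has_integral (x v - x u)) {u..v}"
    and iy: "(b has_integral (y v - y u)) {u..v}"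
    and it: "((\<lambda>s. 2 * (a s * y s - b s * x s)) has_integral (t v - t u)) {u..v}"
    if "\<alpha> \<le> u" "u \<le> v" "v \<le> \<beta>" for u v
    using has_integral_linear[OF int[OF that] bounded_linear_fst]
      has_integral_linear[OF int[OF that] bounded_linear_compose[OF bounded_linear_fst bounded_linear_snd]]
      has_integral_linear[OF int[OF that] bounded_linear_compose[OF bounded_linear_snd bounded_linear_snd]]
    by (simp_all add: o_def g x_def y_def t_def)
  have start: "x \<alpha> = 0" "y \<alpha> = 0" "t \<alpha> = 0" using curve(2) by (auto simp: x_def y_def t_def)
  have ends: "x \<beta> = X" "y \<beta> = Y" "t \<beta> = T" using curve(3) by (auto simp: x_def y_def t_def)
  have cont: "continuous_on {\<alpha>..\<beta>} f"
    if f': "\<And>u v. \<alpha> \<le> u \<Longrightarrow> u \<le> v \<Longrightarrow> v \<le> \<beta> \<Longrightarrow> (f' has_integral (f v - f u)) {u..v}"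
      and f0: "f \<alpha> = 0"
    for f f' :: "real \<Rightarrow> real"
  proof (rule continuous_on_eq[OF indefinite_integral_continuous_1[of f']])
    show "f' integrable_on {\<alpha>..\<beta>}" using f'[of \<alpha> \<beta>] ab by auto
    show "integral {\<alpha>..s} f' = f s" if "s \<in> {\<alpha>..\<beta>}" for s
      using f'[of \<alpha> s] f0 that by (auto simp: integral_unique)
  qed
  note cx = cont[OF ix start(1)] and cy = cont[OF iy start(2)]
  show ?thesis
  proof (cases "\<theta> > 0")
    case True
    show ?thesis
      using horizontal_path_isoperimetric[OF ab ix iy it L cx cy start, of \<theta>] True \<theta> ends by simp
  next
    case False
    have iy': "((\<lambda>s. - b s) has_integral (- y v - - y u)) {u..v}"
      and it': "((\<lambda>s. 2 * (a s * - y s - - b s * x s)) has_integral (- t v - - t u)) {u..v}"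
      if "\<alpha> \<le> u" "u \<le> v" "v \<le> \<beta>" for u v
      using has_integral_neg[OF iy[OF that]] has_integral_neg[OF it[OF that]]
      by (simp_all add: algebra_simps)
    have "- \<theta> * - t \<beta> + - \<theta> * cot (- \<theta>) * ((x \<beta>)\<^sup>2 + (- y \<beta>)\<^sup>2) \<le> L\<^sup>2"
      by (rule horizontal_path_isoperimetric[OF ab ix iy' it' _ cx])
        (use False \<theta> L start cy in \<open>auto intro: continuous_intros\<close>)
    then show ?thesis using ends by simp
  qed
qed

section \<open>Translations and geodesics\<close>

text \<open>The set inside the infimum of \<open>heis_dist\<close>: exhibiting members gives upper
  bounds for the distance, and invariance is an equality of such sets.\<close>

definition heis_lengths :: "heis \<Rightarrow> heis \<Rightarrow> real set" where
  "heis_lengths P Q = {L. \<exists>\<alpha> \<beta> \<gamma> a b. horizontal_curve \<alpha> \<beta> \<gamma> a b \<and> \<gamma> \<alpha> = P \<and> \<gamma> \<beta> = Q \<and>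
     ((\<lambda>s. sqrt ((a s)\<^sup>2 + (b s)\<^sup>2)) has_integral L) {\<alpha>..\<beta>}}"

definition heis_inv :: "heis \<Rightarrow> heis" where
  "heis_inv = (\<lambda>(x, y, t). (- x, - y, - t))"

lemma heis_dist_eq_Inf: "heis_dist P Q = Inf (heis_lengths P Q)"
  by (simp add: heis_dist_def heis_lengths_def)

lemma heis_lengths_nonneg: "L \<in> heis_lengths P Q \<Longrightarrow> 0 \<le> L"
  by (auto simp: heis_lengths_def intro: has_integral_nonneg)

lemma heis_dist_le: "L \<in> heis_lengths P Q \<Longrightarrow> heis_dist P Q \<le> L"
  unfolding heis_dist_eq_Inf by (rule cInf_lower) (auto intro!: bdd_belowI heis_lengths_nonneg)

text \<open>Left translation by \<open>R\<close> is affine with linear part \<open>M\<close>, and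
  \<open>M\<close> carries the horizontal frame at a point to the frame at its translate. The same
  coefficients \<open>a\<close>, \<open>b\<close>, hence the same length, serve for the translated
  curve.\<close>

lemma heis_lengths_translate:
  assumes "L \<in> heis_lengths P Q"
  shows "L \<in> heis_lengths (heis_mult R P) (heis_mult R Q)"
proof -
  obtain r1 r2 r3 where R: "R = (r1, r2, r3)" by (metis prod.exhaust)
  define M :: "heis \<Rightarrow> heis" where
    "M p = (fst p, fst (snd p), snd (snd p) + 2 * (fst p * r2 - r1 * fst (snd p)))" for p
  have "linear M" by (rule linearI) (auto simp: M_def algebra_simps)
  then have M: "bounded_linear M" by (simp add: linear_conv_bounded_linear)
  have RM: "heis_mult R p = R + M p" for p by (cases p) (simp add: heis_mult_def M_def R)
  obtain \<alpha> \<beta> \<gamma> a b where curve: "horizontal_curve \<alpha> \<beta> \<gamma> a b" "\<gamma> \<alpha> = P" "\<gamma> \<beta> = Q"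
    "((\<lambda>s. sqrt ((a s)\<^sup>2 + (b s)\<^sup>2)) has_integral L) {\<alpha>..\<beta>}"
    using assms unfolding heis_lengths_def by blast
  obtain B where B: "B > 0" "\<And>p. norm (M p) \<le> norm p * B"
    using bounded_linear.pos_bounded[OF M] by blast
  have deriv: "((\<lambda>s. heis_mult R (\<gamma> s)) has_vector_derivative
      a s *\<^sub>R heis_X (heis_mult R (\<gamma> s)) + b s *\<^sub>R heis_Y (heis_mult R (\<gamma> s))) (at s within {\<alpha>..\<beta>})"
    if "(\<gamma> has_vector_derivative a s *\<^sub>R heis_X (\<gamma> s) + b s *\<^sub>R heis_Y (\<gamma> s)) (at s within {\<alpha>..\<beta>})" for s
  proof -
    have "M (a s *\<^sub>R heis_X (\<gamma> s) + b s *\<^sub>R heis_Y (\<gamma> s)) =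
        a s *\<^sub>R heis_X (heis_mult R (\<gamma> s)) + b s *\<^sub>R heis_Y (heis_mult R (\<gamma> s))"
      by (cases "\<gamma> s") (simp add: M_def heis_X_def heis_Y_def heis_mult_def R algebra_simps)
    moreover have "((\<lambda>s. R + M (\<gamma> s)) has_vector_derivative
        M (a s *\<^sub>R heis_X (\<gamma> s) + b s *\<^sub>R heis_Y (\<gamma> s))) (at s within {\<alpha>..\<beta>})"
      using has_vector_derivative_add[OF has_vector_derivative_const[of R]
          bounded_linear.has_vector_derivative[OF M that]] by simp
    ultimately show ?thesis by (simp add: RM)
  qed
  have "abs_continuous_curve \<alpha> \<beta> (\<lambda>s. heis_mult R (\<gamma> s))"
  proof (rule abs_continuous_curve_lipschitz_image[OF _ B(1)])
    show "abs_continuous_curve \<alpha> \<beta> \<gamma>" using curve(1) by (simp add: horizontal_curve_def)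
    show "norm (heis_mult R (\<gamma> v) - heis_mult R (\<gamma> u)) \<le> B * norm (\<gamma> v - \<gamma> u)" for u v
      using B(2)[of "\<gamma> v - \<gamma> u"] by (simp add: RM linear_diff[OF \<open>linear M\<close>, symmetric] mult.commute)
  qed
  moreover have ae: "AE s in lebesgue_on {\<alpha>..\<beta>}. (\<gamma> has_vector_derivative
      a s *\<^sub>R heis_X (\<gamma> s) + b s *\<^sub>R heis_Y (\<gamma> s)) (at s within {\<alpha>..\<beta>})"
    using curve(1) unfolding horizontal_curve_def by blast
  have "AE s in lebesgue_on {\<alpha>..\<beta>}. ((\<lambda>s. heis_mult R (\<gamma> s)) has_vector_derivative
      a s *\<^sub>R heis_X (heis_mult R (\<gamma> s)) + b s *\<^sub>R heis_Y (heis_mult R (\<gamma> s))) (at s within {\<alpha>..\<beta>})"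
    by (rule eventually_mono[OF ae deriv])
  ultimately have "horizontal_curve \<alpha> \<beta> (\<lambda>s. heis_mult R (\<gamma> s)) a b"
    using curve(1) by (simp add: horizontal_curve_def)
  then show ?thesis unfolding heis_lengths_def using curve(2-) by blast
qed

lemma heis_dist_translate: "heis_dist P Q = heis_dist 0 (heis_mult (heis_inv P) Q)"
proof -
  have eq: "heis_mult (heis_inv P) P = 0" "heis_mult P 0 = P"
    "heis_mult P (heis_mult (heis_inv P) Q) = Q"
    by (cases P; cases Q; simp add: heis_mult_def heis_inv_def zero_prod_def algebra_simps)+
  have "heis_lengths P Q = heis_lengths 0 (heis_mult (heis_inv P) Q)"
    using heis_lengths_translate[of _ P Q "heis_inv P"]
      heis_lengths_translate[of _ 0 "heis_mult (heis_inv P) Q" P] by (auto simp: eq)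
  then show ?thesis by (simp add: heis_dist_eq_Inf)
qed

text \<open>Source of the explicit upper bounds: the speed is constant on the unit interval, so the
  length is \<open>L\<close>.\<close>

lemma heis_lengths_smooth_curve:
  fixes x y t a b :: "real \<Rightarrow> real"
  assumes x: "\<And>s. (x has_real_derivative a s) (at s)"
    and y: "\<And>s. (y has_real_derivative b s) (at s)"
    and t: "\<And>s. (t has_real_derivative 2 * (a s * y s - b s * x s)) (at s)"
    and cont: "continuous_on {0..1} a" "continuous_on {0..1} b"
    and speed: "\<And>s. (a s)\<^sup>2 + (b s)\<^sup>2 = L\<^sup>2" and "L \<ge> 0"
  shows "L \<in> heis_lengths (x 0, y 0, t 0) (x 1, y 1, t 1)"
proof -
  define \<gamma> where "\<gamma> s = (x s, y s, t s)" for s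
  have eq: "a s *\<^sub>R heis_X (\<gamma> s) + b s *\<^sub>R heis_Y (\<gamma> s) = (a s, b s, 2 * (a s * y s - b s * x s))" for s
    by (simp add: \<gamma>_def heis_X_def heis_Y_def)
  have deriv: "(\<gamma> has_vector_derivative a s *\<^sub>R heis_X (\<gamma> s) + b s *\<^sub>R heis_Y (\<gamma> s)) (at s within {0..1})" for s
    unfolding eq unfolding \<gamma>_def
    by (intro has_vector_derivative_Pair)
      (use x y t in \<open>auto simp: has_real_derivative_iff_has_vector_derivative intro: has_vector_derivative_at_within\<close>)
  have cxy: "continuous_on {0..1} x" "continuous_on {0..1} y"
    by (meson DERIV_continuous_on x has_field_derivative_at_within, meson DERIV_continuous_on y has_field_derivative_at_within)
  have "abs_continuous_curve 0 1 \<gamma>"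
    by (rule abs_continuous_curve_C1[OF deriv]) (unfold eq, intro continuous_intros cont cxy)
  then have "horizontal_curve 0 1 \<gamma> a b"
    using cont deriv unfolding horizontal_curve_def
    by (auto intro: continuous_imp_measurable_on_sets_lebesgue)
  moreover have "((\<lambda>s. sqrt ((a s)\<^sup>2 + (b s)\<^sup>2)) has_integral L) {0..1}"
    using has_integral_const_real[of L 0 1] \<open>L \<ge> 0\<close> by (simp add: speed)
  ultimately show ?thesis unfolding heis_lengths_def \<gamma>_def by blast
qed

lemma heis_lengths_line: "sqrt (X\<^sup>2 + Y\<^sup>2) \<in> heis_lengths 0 (X, Y, 0)"
proof -
  have d: "((\<lambda>s. s * Z) has_real_derivative Z) (at s)" for s Z :: real
    by (auto intro!: derivative_eq_intros)
  show ?thesis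
    using heis_lengths_smooth_curve[of "\<lambda>s. s * X" "\<lambda>_. X" "\<lambda>s. s * Y" "\<lambda>_. Y" "\<lambda>_. 0" "sqrt (X\<^sup>2 + Y\<^sup>2)", OF d d]
    by (simp add: zero_prod_def)
qed

text \<open>Lift of the planar circular arc with initial velocity \<open>(v, w)\<close> whose
  velocity turns clockwise at constant rate through the total angle
  \<open>2 * \<theta>\<close>.\<close>

lemma heis_lengths_circular_arc:
  fixes v w \<theta> :: real
  assumes "\<theta> \<noteq> 0"
  shows "sqrt (v\<^sup>2 + w\<^sup>2) \<in> heis_lengths 0
    ((v * sin (2 * \<theta>) + w * (1 - cos (2 * \<theta>))) / (2 * \<theta>),
     (w * sin (2 * \<theta>) - v * (1 - cos (2 * \<theta>))) / (2 * \<theta>),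
     (v\<^sup>2 + w\<^sup>2) * (2 * \<theta> - sin (2 * \<theta>)) / (2 * \<theta>\<^sup>2))"
proof -
  define a b x y t where "a s = v * cos (2 * \<theta> * s) + w * sin (2 * \<theta> * s)"
    and "b s = w * cos (2 * \<theta> * s) - v * sin (2 * \<theta> * s)"
    and "x s = (v * sin (2 * \<theta> * s) + w * (1 - cos (2 * \<theta> * s))) / (2 * \<theta>)"
    and "y s = (w * sin (2 * \<theta> * s) - v * (1 - cos (2 * \<theta> * s))) / (2 * \<theta>)"
    and "t s = (v\<^sup>2 + w\<^sup>2) * (2 * \<theta> * s - sin (2 * \<theta> * s)) / (2 * \<theta>\<^sup>2)" for s
  have "sqrt (v\<^sup>2 + w\<^sup>2) \<in> heis_lengths (x 0, y 0, t 0) (x 1, y 1, t 1)"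
  proof (rule heis_lengths_smooth_curve[of x a y b t])
    fix s
    let ?c = "cos (2 * \<theta> * s)" and ?s = "sin (2 * \<theta> * s)"
    show "(x has_real_derivative a s) (at s)" "(y has_real_derivative b s) (at s)"
      unfolding x_def[abs_def] y_def[abs_def] a_def b_def using assms
      by (auto intro!: derivative_eq_intros simp: field_simps)
    have sc: "?s\<^sup>2 = 1 - ?c\<^sup>2" using sin_cos_squared_add[of "2 * \<theta> * s"] by linarith
    have xy: "2 * \<theta> * x s = v * ?s + w * (1 - ?c)" "2 * \<theta> * y s = w * ?s - v * (1 - ?c)"
      using assms by (simp_all add: x_def y_def)
    have "2 * (a s * y s - b s * x s) * \<theta> = a s * (2 * \<theta> * y s) - b s * (2 * \<theta> * x s)"
      by (simp add: algebra_simps)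
    also have "\<dots> = (v\<^sup>2 + w\<^sup>2) * (?s\<^sup>2 + ?c\<^sup>2 - ?c)"
      unfolding xy a_def b_def by algebra
    finally have "2 * (a s * y s - b s * x s) = (v\<^sup>2 + w\<^sup>2) * (1 - ?c) / \<theta>"
      using assms by (simp add: sc eq_divide_eq)
    then have e: "2 * (a s * y s - b s * x s) = (v\<^sup>2 + w\<^sup>2) * (1 - ?c) / \<theta>" .
    have "(t has_real_derivative (v\<^sup>2 + w\<^sup>2) * (2 * \<theta> - ?c * (2 * \<theta>)) / (2 * \<theta>\<^sup>2)) (at s)"
      unfolding t_def[abs_def] by (rule DERIV_cdivide) (auto intro!: derivative_eq_intros)
    moreover have "(v\<^sup>2 + w\<^sup>2) * (2 * \<theta> - ?c * (2 * \<theta>)) / (2 * \<theta>\<^sup>2) = (v\<^sup>2 + w\<^sup>2) * (1 - ?c) / \<theta>"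
      using assms by (simp add: field_simps power2_eq_square)
    ultimately show "(t has_real_derivative 2 * (a s * y s - b s * x s)) (at s)" unfolding e by simp
    have "(a s)\<^sup>2 + (b s)\<^sup>2 = (v\<^sup>2 + w\<^sup>2) * (?s\<^sup>2 + ?c\<^sup>2)"
      unfolding a_def b_def by algebra
    then show "(a s)\<^sup>2 + (b s)\<^sup>2 = (sqrt (v\<^sup>2 + w\<^sup>2))\<^sup>2" by simp
  qed (auto simp: a_def[abs_def] b_def[abs_def] intro!: continuous_intros)
  then show ?thesis by (simp add: x_def y_def t_def zero_prod_def)
qed

lemma heis_lengths_vertical: "sqrt (pi * \<bar>T\<bar>) \<in> heis_lengths 0 (0, 0, T)"
proof -
  \<comment> \<open>A full turn closes the projected circle; its orientation gives the sign of the
    height. A circle of length \<open>sqrt (pi * |T|)\<close> encloses the area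
    \<open>|T| / 4\<close>, and heights are four times areas.\<close>
  define \<theta> where \<theta>: "\<theta> = (if T \<ge> 0 then pi else - pi)"
  have s: "sin (2 * \<theta>) = 0" "cos (2 * \<theta>) = 1" "\<theta> \<noteq> 0" by (auto simp: \<theta>)
  have "pi * \<bar>T\<bar> * (2 * \<theta>) / (2 * \<theta>\<^sup>2) = T" by (auto simp: \<theta> power2_eq_square)
  then show ?thesis
    using heis_lengths_circular_arc[OF s(3), of "sqrt (pi * \<bar>T\<bar>)" 0] s by simp
qed

text \<open>The hypothesis on \<open>T\<close> says that the height is four times the signed area of
  the circular segment cut off by the chord from 0 to \<open>(X, Y)\<close> on an arc of total
  turning \<open>2 * \<theta>\<close>. The ratio of arc to chord is
  \<open>\<theta> / sin \<theta>\<close>.\<close>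

lemma heis_lengths_chord:
  fixes X Y T \<theta> :: real
  assumes "0 < \<bar>\<theta>\<bar>" "\<bar>\<theta>\<bar> < pi" and T: "T * (sin \<theta>)\<^sup>2 = (X\<^sup>2 + Y\<^sup>2) * (\<theta> - sin \<theta> * cos \<theta>)"
  shows "sqrt (X\<^sup>2 + Y\<^sup>2) * (\<theta> / sin \<theta>) \<in> heis_lengths 0 (X, Y, T)"
proof -
  have s0: "sin \<theta> \<noteq> 0" using assms(1,2) sin_gt_zero[of "\<bar>\<theta>\<bar>"] by (auto simp: abs_if split: if_splits)
  have pos: "\<theta> / sin \<theta> > 0"
    using assms(1,2) sin_gt_zero[of "\<bar>\<theta>\<bar>"] by (auto simp: abs_if zero_less_divide_iff split: if_splits)
  \<comment> \<open>The tangent makes the angle \<open>\<theta>\<close> with the chord, so the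
    initial velocity is the chord rotated by \<open>\<theta>\<close> and stretched by
    \<open>k\<close>, the ratio of arc to chord.\<close>
  define k v w where "k = \<theta> / sin \<theta>" and "v = (X * cos \<theta> - Y * sin \<theta>) * k" and "w = (X * sin \<theta> + Y * cos \<theta>) * k"
  have sc: "(sin \<theta>)\<^sup>2 = 1 - (cos \<theta>)\<^sup>2" using sin_cos_squared_add[of \<theta>] by linarith
  have "v\<^sup>2 + w\<^sup>2 = (X\<^sup>2 + Y\<^sup>2) * ((sin \<theta>)\<^sup>2 + (cos \<theta>)\<^sup>2) * k\<^sup>2"
    unfolding v_def w_def by algebra
  then have vw: "v\<^sup>2 + w\<^sup>2 = (X\<^sup>2 + Y\<^sup>2) * k\<^sup>2" by simp
  have kp: "k > 0" using pos by (simp add: k_def)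
  then have L: "sqrt (v\<^sup>2 + w\<^sup>2) = sqrt (X\<^sup>2 + Y\<^sup>2) * k" by (simp add: vw real_sqrt_mult)
  have c2: "1 - cos (2 * \<theta>) = 2 * (sin \<theta>)\<^sup>2" by (simp add: cos_double sc)
  have \<theta>0: "\<theta> \<noteq> 0" using assms(1) by simp
  have k0: "k \<noteq> 0" using kp by simp
  have "(v * sin (2 * \<theta>) + w * (1 - cos (2 * \<theta>))) / (2 * \<theta>) = (v * cos \<theta> + w * sin \<theta>) / k"
    unfolding c2 sin_double k_def using s0 \<theta>0 by (simp add: field_simps power2_eq_square)
  also have "v * cos \<theta> + w * sin \<theta> = X * ((sin \<theta>)\<^sup>2 + (cos \<theta>)\<^sup>2) * k"
    unfolding v_def w_def by algebra
  finally have 1: "(v * sin (2 * \<theta>) + w * (1 - cos (2 * \<theta>))) / (2 * \<theta>) = X" using k0 by simp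
  have "(w * sin (2 * \<theta>) - v * (1 - cos (2 * \<theta>))) / (2 * \<theta>) = (w * cos \<theta> - v * sin \<theta>) / k"
    unfolding c2 sin_double k_def using s0 \<theta>0 by (simp add: field_simps power2_eq_square)
  also have "w * cos \<theta> - v * sin \<theta> = Y * ((sin \<theta>)\<^sup>2 + (cos \<theta>)\<^sup>2) * k"
    unfolding v_def w_def by algebra
  finally have 2: "(w * sin (2 * \<theta>) - v * (1 - cos (2 * \<theta>))) / (2 * \<theta>) = Y" using k0 by simp
  have "(v\<^sup>2 + w\<^sup>2) * (2 * \<theta> - sin (2 * \<theta>)) / (2 * \<theta>\<^sup>2) = (X\<^sup>2 + Y\<^sup>2) * (\<theta> - sin \<theta> * cos \<theta>) / (sin \<theta>)\<^sup>2"
    unfolding vw k_def sin_double using assms(1) s0 by (simp add: field_simps power2_eq_square)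
  also have "\<dots> = T" using s0 by (simp flip: T)
  finally have 3: "(v\<^sup>2 + w\<^sup>2) * (2 * \<theta> - sin (2 * \<theta>)) / (2 * \<theta>\<^sup>2) = T" .
  show ?thesis
    using heis_lengths_circular_arc[of \<theta> v w] assms(1) unfolding 1 2 3 L k_def by simp
qed

section \<open>Distance to the origin\<close>

abbreviation heis_norm :: "heis \<Rightarrow> real" where
  "heis_norm \<equiv> heis_dist 0"

lemma mult_cot_le_1:
  fixes \<theta> :: real
  assumes "0 < \<bar>\<theta>\<bar>" "\<bar>\<theta>\<bar> < pi"
  shows "\<theta> * cot \<theta> \<le> 1"
proof -
  have *: "u * cot u \<le> 1" if "0 < u" "u < pi" for u :: real
    using mult_cos_le_sin[of u] that sin_gt_zero[of u] by (simp add: cot_def field_simps)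
  show ?thesis using *[of "\<bar>\<theta>\<bar>"] assms by (cases "\<theta> > 0") auto
qed

text \<open>Intermediate value theorem for the difference \<open>F\<close> of the two sides. Since
  \<open>F 0 = 0\<close>, the left endpoint has to be a positive angle at which \<open>F\<close> is
  not positive.\<close>

lemma ex_chord_angle_pos:
  fixes R T :: real
  assumes "R > 0" "T > 0"
  shows "\<exists>\<theta>. 0 < \<theta> \<and> \<theta> < pi \<and> T * (sin \<theta>)\<^sup>2 = R * (\<theta> - sin \<theta> * cos \<theta>)"
proof -
  define F where "F \<theta> = R * (\<theta> - sin \<theta> * cos \<theta>) - T * (sin \<theta>)\<^sup>2" for \<theta>
  \<comment> \<open>At \<open>tan u = T / (2 * R)\<close> the inequality
    \<open>u \<le> tan u\<close> gives \<open>u - sin u * cos u \<le> tan u * (sin u)^2\<close>,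
    hence \<open>F u \<le> - T * (sin u)^2 / 2\<close>.\<close>
  define u where "u = arctan (T / (2 * R))"
  have u: "0 < u" "u < pi / 2" using assms arctan_ubound[of "T / (2 * R)"] by (auto simp: u_def)
  have upi: "u < pi" using u by simp
  have sc: "sin u > 0" "cos u > 0" using u by (auto intro!: sin_gt_zero cos_gt_zero)
  have tan: "sin u / cos u = T / (2 * R)" using tan_arctan[of "T / (2 * R)"] unfolding u_def tan_def .
  have "u \<le> sin u / cos u" using mult_cos_le_sin[of u] u sc by (simp add: field_simps)
  then have "u - sin u * cos u \<le> sin u / cos u - sin u * cos u" by simp
  also have "\<dots> = sin u * (1 - (cos u)\<^sup>2) / cos u" using sc by (simp add: field_simps power2_eq_square)
  also have "\<dots> = (sin u)\<^sup>2 * (sin u / cos u)"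
    using sin_squared_eq[of u] by (simp add: power2_eq_square)
  also have "\<dots> = (sin u)\<^sup>2 * (T / (2 * R))" by (simp only: tan)
  finally have "R * (u - sin u * cos u) \<le> R * ((sin u)\<^sup>2 * (T / (2 * R)))"
    using assms(1) by (intro mult_left_mono) auto
  moreover have "R * ((sin u)\<^sup>2 * (T / (2 * R))) = T * (sin u)\<^sup>2 / 2" using assms(1) by simp
  moreover have "T * (sin u)\<^sup>2 \<ge> 0" using assms by simp
  ultimately have "F u \<le> 0" unfolding F_def by linarith
  moreover have "F pi > 0" using assms by (simp add: F_def)
  moreover have "continuous_on {u..pi} F" unfolding F_def[abs_def] by (intro continuous_intros)
  ultimately obtain \<theta> where \<theta>: "u \<le> \<theta>" "\<theta> \<le> pi" "F \<theta> = 0"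
    using IVT'[of F u 0 pi] upi by auto
  moreover have "\<theta> \<noteq> pi" using \<theta>(3) \<open>F pi > 0\<close> by auto
  ultimately show ?thesis using u by (intro exI[of _ \<theta>]) (auto simp: F_def)
qed

lemma ex_chord_angle:
  fixes R T :: real
  assumes "R > 0" "T \<noteq> 0"
  shows "\<exists>\<theta>. 0 < \<bar>\<theta>\<bar> \<and> \<bar>\<theta>\<bar> < pi \<and> T * (sin \<theta>)\<^sup>2 = R * (\<theta> - sin \<theta> * cos \<theta>)"
proof (cases "T > 0")
  case True
  then show ?thesis using ex_chord_angle_pos[OF assms(1) True] by (metis abs_of_pos)
next
  case False
  then obtain \<theta> where "0 < \<theta>" "\<theta> < pi" "- T * (sin \<theta>)\<^sup>2 = R * (\<theta> - sin \<theta> * cos \<theta>)"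
    using ex_chord_angle_pos[OF assms(1), of "- T"] assms(2) by auto
  then show ?thesis by (intro exI[of _ "- \<theta>"]) (auto simp: algebra_simps)
qed

text \<open>A line, a full circle or a circular arc reaches every point, so lower bounds valid for
  all lengths pass to the infimum.\<close>

lemma heis_lengths_nonempty: "heis_lengths 0 Q \<noteq> {}"
proof -
  obtain X Y T where Q: "Q = (X, Y, T)" by (metis prod.exhaust)
  consider "X\<^sup>2 + Y\<^sup>2 = 0" | "T = 0" | "X\<^sup>2 + Y\<^sup>2 > 0" "T \<noteq> 0"
    by (metis sum_power2_gt_zero_iff sum_power2_eq_zero_iff)
  then show ?thesis
  proof cases
    case 1
    then have "X = 0" "Y = 0" by (auto simp: sum_power2_eq_zero_iff)
    then show ?thesis using heis_lengths_vertical[of T] by (auto simp: Q)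
  next
    case 2
    then show ?thesis using heis_lengths_line[of X Y] by (auto simp: Q)
  next
    case 3
    then obtain \<theta> where "0 < \<bar>\<theta>\<bar>" "\<bar>\<theta>\<bar> < pi" "T * (sin \<theta>)\<^sup>2 = (X\<^sup>2 + Y\<^sup>2) * (\<theta> - sin \<theta> * cos \<theta>)"
      using ex_chord_angle by blast
    then show ?thesis using heis_lengths_chord Q by blast
  qed
qed

lemma heis_norm_nonneg: "heis_norm Q \<ge> 0"
  unfolding heis_dist_eq_Inf by (rule cInf_greatest[OF heis_lengths_nonempty heis_lengths_nonneg])

lemma heis_norm_lower:
  assumes "0 < \<bar>\<theta>\<bar>" "\<bar>\<theta>\<bar> < pi"
  shows "\<theta> * T + \<theta> * cot \<theta> * (X\<^sup>2 + Y\<^sup>2) \<le> (heis_norm (X, Y, T))\<^sup>2" (is "?c \<le> _")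
proof (cases "?c \<le> 0")
  case True
  then show ?thesis using zero_le_power2 order_trans by blast
next
  case False
  have "sqrt ?c \<le> heis_norm (X, Y, T)"
    unfolding heis_dist_eq_Inf
  proof (rule cInf_greatest[OF heis_lengths_nonempty])
    fix L assume L: "L \<in> heis_lengths 0 (X, Y, T)"
    then have "?c \<le> L\<^sup>2"
      unfolding heis_lengths_def using horizontal_curve_lower_bound[OF _ _ _ _ assms] by blast
    then show "sqrt ?c \<le> L" using heis_lengths_nonneg[OF L] real_le_lsqrt by blast
  qed
  then have "(sqrt ?c)\<^sup>2 \<le> (heis_norm (X, Y, T))\<^sup>2" using False by (intro power_mono) auto
  then show ?thesis using False by simp
qed

text \<open>Limit of \<open>heis_norm_lower\<close> as the angle decreases to 0, after replacing
  \<open>\<theta> * cot \<theta>\<close> by the smaller \<open>cos \<theta>\<close>, which is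
  continuous at 0.\<close>

lemma heis_norm_ge_horizontal: "X\<^sup>2 + Y\<^sup>2 \<le> (heis_norm (X, Y, T))\<^sup>2"
proof (rule tendsto_upperbound)
  show "((\<lambda>\<theta>. \<theta> * T + cos \<theta> * (X\<^sup>2 + Y\<^sup>2)) \<longlongrightarrow> X\<^sup>2 + Y\<^sup>2) (at_right 0)"
    by (auto intro!: tendsto_eq_intros)
  have "\<theta> * T + cos \<theta> * (X\<^sup>2 + Y\<^sup>2) \<le> (heis_norm (X, Y, T))\<^sup>2" if "0 < \<theta>" "\<theta> < pi / 2" for \<theta>
  proof -
    have "cos \<theta> > 0" "sin \<theta> > 0" using that by (auto intro!: sin_gt_zero cos_gt_zero)
    then have "cos \<theta> * (X\<^sup>2 + Y\<^sup>2) \<le> \<theta> * cot \<theta> * (X\<^sup>2 + Y\<^sup>2)"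
      using sin_x_le_x[of \<theta>] that by (intro mult_right_mono) (auto simp: cot_def field_simps)
    then show ?thesis using heis_norm_lower[of \<theta> T X Y] that by auto
  qed
  then show "\<forall>\<^sub>F \<theta> in at_right 0. \<theta> * T + cos \<theta> * (X\<^sup>2 + Y\<^sup>2) \<le> (heis_norm (X, Y, T))\<^sup>2"
    unfolding eventually_at_right_field by (intro exI[of _ "pi / 2"]) auto
qed auto

lemma heis_norm_horizontal: "heis_norm (X, Y, 0) = sqrt (X\<^sup>2 + Y\<^sup>2)"
proof (rule antisym)
  show "heis_norm (X, Y, 0) \<le> sqrt (X\<^sup>2 + Y\<^sup>2)" by (rule heis_dist_le[OF heis_lengths_line])
  show "sqrt (X\<^sup>2 + Y\<^sup>2) \<le> heis_norm (X, Y, 0)"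
    using real_le_lsqrt[OF heis_norm_nonneg heis_norm_ge_horizontal] .
qed

lemma heis_norm_vertical: "heis_norm (0, 0, T) = sqrt (pi * \<bar>T\<bar>)"
proof (rule antisym)
  show "heis_norm (0, 0, T) \<le> sqrt (pi * \<bar>T\<bar>)" by (rule heis_dist_le[OF heis_lengths_vertical])
  \<comment> \<open>The lower bound requires an angle of modulus less than \<open>pi\<close>, so it
    is used at \<open>z * pi\<close> and \<open>- z * pi\<close> for \<open>z < 1\<close>; together
    they yield the absolute value.\<close>
  have "pi * \<bar>T\<bar> \<le> (heis_norm (0, 0, T))\<^sup>2"
  proof (rule field_le_mult_one_interval)
    fix z :: real assume z: "0 < z" "z < 1"
    have "z * pi < pi" using z by simp
    then have "z * pi * T \<le> (heis_norm (0, 0, T))\<^sup>2" "- (z * pi) * T \<le> (heis_norm (0, 0, T))\<^sup>2"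
      using heis_norm_lower[of "z * pi" T 0 0] heis_norm_lower[of "- (z * pi)" T 0 0] z by auto
    then show "z * (pi * \<bar>T\<bar>) \<le> (heis_norm (0, 0, T))\<^sup>2" by (auto simp: abs_if mult.assoc)
  qed
  then show "sqrt (pi * \<bar>T\<bar>) \<le> heis_norm (0, 0, T)"
    using real_le_lsqrt[OF heis_norm_nonneg] by blast
qed

text \<open>At the angle of the arc the squared length of the arc equals the lower bound, so the arc
  is a geodesic.\<close>

lemma heis_norm_chord:
  assumes \<theta>: "0 < \<bar>\<theta>\<bar>" "\<bar>\<theta>\<bar> < pi" and T: "T * (sin \<theta>)\<^sup>2 = (X\<^sup>2 + Y\<^sup>2) * (\<theta> - sin \<theta> * cos \<theta>)"
  shows "heis_norm (X, Y, T) = sqrt (X\<^sup>2 + Y\<^sup>2) * (\<theta> / sin \<theta>)"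
    "(heis_norm (X, Y, T))\<^sup>2 = \<theta> * T + \<theta> * cot \<theta> * (X\<^sup>2 + Y\<^sup>2)"
proof -
  let ?L = "sqrt (X\<^sup>2 + Y\<^sup>2) * (\<theta> / sin \<theta>)"
  have L: "?L \<in> heis_lengths 0 (X, Y, T)" by (rule heis_lengths_chord[OF assms])
  have s0: "sin \<theta> \<noteq> 0" using \<theta> sin_gt_zero[of "\<bar>\<theta>\<bar>"] by (auto simp: abs_if split: if_splits)
  have T': "T = (X\<^sup>2 + Y\<^sup>2) * (\<theta> - sin \<theta> * cos \<theta>) / (sin \<theta>)\<^sup>2" using T s0 by (simp add: eq_divide_eq)
  have "?L\<^sup>2 = (X\<^sup>2 + Y\<^sup>2) * \<theta>\<^sup>2 / (sin \<theta>)\<^sup>2" by (simp add: power_mult_distrib power_divide)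
  also have "\<dots> = \<theta> * T + \<theta> * cot \<theta> * (X\<^sup>2 + Y\<^sup>2)"
    unfolding T' cot_def using s0 by (simp add: field_simps power2_eq_square)
  finally have eq: "?L\<^sup>2 = \<theta> * T + \<theta> * cot \<theta> * (X\<^sup>2 + Y\<^sup>2)" .
  then have "?L \<le> heis_norm (X, Y, T)"
    using heis_norm_lower[OF \<theta>, of T X Y] heis_norm_nonneg power2_le_imp_le by metis
  then show 1: "heis_norm (X, Y, T) = ?L" using heis_dist_le[OF L] by simp
  show "(heis_norm (X, Y, T))\<^sup>2 = \<theta> * T + \<theta> * cot \<theta> * (X\<^sup>2 + Y\<^sup>2)" unfolding 1 eq ..
qed

text \<open>Invariance under rotations about the vertical axis, read off from the explicit formulas
  in the three cases.\<close>

lemma heis_norm_cong: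
  assumes "X\<^sup>2 + Y\<^sup>2 = X'\<^sup>2 + Y'\<^sup>2"
  shows "heis_norm (X, Y, T) = heis_norm (X', Y', T)"
proof -
  consider "X\<^sup>2 + Y\<^sup>2 = 0" | "T = 0" | "X\<^sup>2 + Y\<^sup>2 > 0" "T \<noteq> 0"
    by (metis sum_power2_gt_zero_iff sum_power2_eq_zero_iff)
  then show ?thesis
  proof cases
    case 1
    then have "X = 0" "Y = 0" "X' = 0" "Y' = 0" using assms by (auto simp: sum_power2_eq_zero_iff)
    then show ?thesis by simp
  next
    case 2
    then show ?thesis by (simp add: heis_norm_horizontal assms)
  next
    case 3
    then obtain \<theta> where "0 < \<bar>\<theta>\<bar>" "\<bar>\<theta>\<bar> < pi" "T * (sin \<theta>)\<^sup>2 = (X\<^sup>2 + Y\<^sup>2) * (\<theta> - sin \<theta> * cos \<theta>)"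
      using ex_chord_angle by blast
    then show ?thesis using heis_norm_chord(1)[of \<theta> T X Y] heis_norm_chord(1)[of \<theta> T X' Y'] assms by simp
  qed
qed

section \<open>Comparison of the norm with the horizontal and vertical parts\<close>

lemma heis_norm_upper: "(heis_norm (X, Y, T))\<^sup>2 \<le> X\<^sup>2 + Y\<^sup>2 + pi * \<bar>T\<bar>"
proof -
  consider "X\<^sup>2 + Y\<^sup>2 = 0" | "T = 0" | "X\<^sup>2 + Y\<^sup>2 > 0" "T \<noteq> 0"
    by (metis sum_power2_gt_zero_iff sum_power2_eq_zero_iff)
  then show ?thesis
  proof cases
    case 1
    then have "X = 0" "Y = 0" by (auto simp: sum_power2_eq_zero_iff)
    then show ?thesis by (simp add: heis_norm_vertical)
  next
    case 2
    then show ?thesis by (simp add: heis_norm_horizontal)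
  next
    case 3
    then obtain \<theta> where \<theta>: "0 < \<bar>\<theta>\<bar>" "\<bar>\<theta>\<bar> < pi" "T * (sin \<theta>)\<^sup>2 = (X\<^sup>2 + Y\<^sup>2) * (\<theta> - sin \<theta> * cos \<theta>)"
      using ex_chord_angle by blast
    have "\<theta> * T \<le> \<bar>\<theta>\<bar> * \<bar>T\<bar>" by (metis abs_ge_self abs_mult)
    also have "\<dots> \<le> pi * \<bar>T\<bar>" using \<theta>(2) by (intro mult_right_mono) auto
    finally have "\<theta> * T \<le> pi * \<bar>T\<bar>" .
    moreover have "\<theta> * cot \<theta> * (X\<^sup>2 + Y\<^sup>2) \<le> 1 * (X\<^sup>2 + Y\<^sup>2)"
      using mult_cot_le_1[OF \<theta>(1,2)] by (intro mult_right_mono) auto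
    ultimately show ?thesis using heis_norm_chord(2)[OF \<theta>] by simp
  qed
qed

text \<open>Near the vertical axis the optimal angle is close to \<open>pi\<close> in modulus. The
  lower bound is taken at \<open>pi - u\<close> for \<open>T \<ge> 0\<close> and at
  \<open>u - pi\<close> otherwise, with \<open>u\<close> tuned to the ratio of the two
  parts.\<close>

lemma heis_norm_lower_vertical:
  "pi * \<bar>T\<bar> - 2 * sqrt (X\<^sup>2 + Y\<^sup>2) * sqrt (pi * \<bar>T\<bar>) \<le> (heis_norm (X, Y, T))\<^sup>2"
proof -
  define r a where "r = sqrt (X\<^sup>2 + Y\<^sup>2)" and "a = sqrt (pi * \<bar>T\<bar>)"
  have r0: "r \<ge> 0" "X\<^sup>2 + Y\<^sup>2 = r\<^sup>2" and a0: "a \<ge> 0" "pi * \<bar>T\<bar> = a\<^sup>2" by (auto simp: r_def a_def)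
  consider "a \<le> 2 * r" | "r = 0" | "2 * r < a" "r > 0" using r0 by linarith
  then have "a\<^sup>2 - 2 * r * a \<le> (heis_norm (X, Y, T))\<^sup>2"
  proof cases
    case 1
    then have "a * (a - 2 * r) \<le> 0" using a0 by (intro mult_nonneg_nonpos) auto
    then have "a\<^sup>2 - 2 * r * a \<le> 0" by (simp add: power2_eq_square algebra_simps)
    then show ?thesis using zero_le_power2 order_trans by blast
  next
    case 2
    then have "X = 0" "Y = 0" by (auto simp: r_def)
    then show ?thesis using 2 a0 by (simp add: heis_norm_vertical)
  next
    case 3
    have a: "a > 0" using 3 by linarith
    \<comment> \<open>This \<open>u\<close> minimises the loss
      \<open>u * |T| + pi * r^2 / u\<close>, whose two terms both become \<open>r * a\<close>. The
      assumption \<open>2 * r < a\<close> gives \<open>u < pi / 2\<close>.\<close>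
    define u where "u = r * pi / a"
    have u: "u > 0" "u < pi / 2" using 3 a by (auto simp: u_def field_simps)
    have "(u - pi) * cot u \<ge> - (pi / u)"
    proof -
      have "cot u \<le> 1 / u" using mult_cot_le_1[of u] u by (simp add: field_simps)
      then have "(pi - u) * cot u \<le> (pi - u) * (1 / u)" using u by (intro mult_left_mono) auto
      also have "\<dots> \<le> pi / u" using u by (simp add: field_simps)
      finally show ?thesis by (simp add: algebra_simps)
    qed
    then have "- (pi / u) * r\<^sup>2 \<le> (u - pi) * cot u * r\<^sup>2" by (intro mult_right_mono) auto
    moreover have "pi / u * r\<^sup>2 = r * a" using 3 a by (simp add: u_def power2_eq_square)
    moreover have "u * \<bar>T\<bar> = r * a" using a a0(2) by (simp add: u_def field_simps power2_eq_square)
    moreover have "\<theta> * T + \<theta> * cot \<theta> * r\<^sup>2 \<le> (heis_norm (X, Y, T))\<^sup>2" if "0 < \<bar>\<theta>\<bar>" "\<bar>\<theta>\<bar> < pi" for \<theta>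
      using heis_norm_lower[OF that, of T X Y] r0 by simp
    note this[of "pi - u"] this[of "u - pi"]
    moreover have "cot (pi - u) = - cot u" "cot (u - pi) = cot u"
      by (auto simp: cot_def sin_diff cos_diff)
    ultimately show ?thesis
      using u a0(2) by (cases "T \<ge> 0") (auto simp: algebra_simps)
  qed
  then show ?thesis by (simp add: r_def a_def)
qed

text \<open>Together with \<open>heis_norm_le\<close> this lets \<open>sqrt (pi * |T|)\<close>
  replace the norm near the vertical axis, with an error linear in the horizontal part.\<close>

lemma heis_norm_ge: "sqrt (pi * \<bar>T\<bar>) - 2 * sqrt (X\<^sup>2 + Y\<^sup>2) \<le> heis_norm (X, Y, T)"
proof -
  define r a where "r = sqrt (X\<^sup>2 + Y\<^sup>2)" and "a = sqrt (pi * \<bar>T\<bar>)"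
  have r0: "r \<ge> 0" and a0: "a \<ge> 0" "pi * \<bar>T\<bar> = a\<^sup>2" by (auto simp: r_def a_def)
  have "a - 2 * r \<le> heis_norm (X, Y, T)"
  proof (cases "2 * r \<le> a")
    case True
    have "2 * r * (2 * r) \<le> 2 * r * a" using r0 True by (intro mult_left_mono) auto
    then have "(a - 2 * r)\<^sup>2 \<le> a\<^sup>2 - 2 * r * a" by (simp add: power2_eq_square algebra_simps)
    also have "\<dots> \<le> (heis_norm (X, Y, T))\<^sup>2"
      using heis_norm_lower_vertical[of T X Y] by (simp add: r_def a_def)
    finally show ?thesis using heis_norm_nonneg power2_le_imp_le by blast
  qed (use heis_norm_nonneg[of "(X, Y, T)"] in linarith)
  then show ?thesis by (simp add: r_def a_def)
qed

lemma heis_norm_le: "heis_norm (X, Y, T) \<le> sqrt (X\<^sup>2 + Y\<^sup>2) + sqrt (pi * \<bar>T\<bar>)"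
proof (rule power2_le_imp_le)
  have "(heis_norm (X, Y, T))\<^sup>2 \<le> (sqrt (X\<^sup>2 + Y\<^sup>2))\<^sup>2 + (sqrt (pi * \<bar>T\<bar>))\<^sup>2"
    using heis_norm_upper by simp
  also have "\<dots> \<le> (sqrt (X\<^sup>2 + Y\<^sup>2) + sqrt (pi * \<bar>T\<bar>))\<^sup>2"
    by (simp add: power2_sum)
  finally show "(heis_norm (X, Y, T))\<^sup>2 \<le> \<dots>" .
qed simp

text \<open>With \<open>h = (\<theta> / 2) cot (\<theta> / 2)\<close> one has \<open>\<theta> cot \<theta> = h - \<theta>\<^sup>2 / (4 h)\<close>; the angle \<open>\<theta> / 2\<close> is
  that of the two halves of a geodesic of angle \<open>\<theta>\<close>.\<close>
lemma heis_norm_half_angle: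
  assumes "X\<^sup>2 + Y\<^sup>2 > 0"
  obtains \<theta> h where "h > 0" "sqrt (X\<^sup>2 + Y\<^sup>2) \<le> heis_norm (X, Y, T) * h"
    "(heis_norm (X, Y, T))\<^sup>2 = \<theta> * T + (X\<^sup>2 + Y\<^sup>2) * (h - \<theta>\<^sup>2 / (4 * h))"
    "\<And>x y t. (\<theta> / 2) * t + h * (x\<^sup>2 + y\<^sup>2) \<le> (heis_norm (x, y, t))\<^sup>2"
proof (cases "T = 0")
  case True
  \<comment> \<open>For a horizontal point the angle is 0, and \<open>h\<close> takes its limit
    value 1.\<close>
  then show ?thesis
    using that[of 1 0] assms heis_norm_ge_horizontal by (simp add: heis_norm_horizontal)
next
  case False
  obtain \<theta> where \<theta>: "0 < \<bar>\<theta>\<bar>" "\<bar>\<theta>\<bar> < pi" "T * (sin \<theta>)\<^sup>2 = (X\<^sup>2 + Y\<^sup>2) * (\<theta> - sin \<theta> * cos \<theta>)"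
    using ex_chord_angle[OF assms False] by blast
  define u where "u = \<theta> / 2"
  define h where "h = u * cot u"
  have \<theta>u: "\<theta> = 2 * u" by (simp add: u_def)
  have u: "0 < \<bar>u\<bar>" "\<bar>u\<bar> < pi / 2" using \<theta> by (auto simp: u_def)
  have c: "cos u > 0" using u by (intro cos_gt_zero_pi) auto
  have us: "u / sin u > 0"
    using u sin_gt_zero[of "\<bar>u\<bar>"] by (auto simp: abs_if zero_less_divide_iff split: if_splits)
  have s0: "sin u \<noteq> 0" using us by auto
  have h: "h > 0" using us c by (simp add: h_def cot_def) (metis mult_pos_pos mult.commute times_divide_eq_right)
  show ?thesis
  proof (rule that[of h \<theta>])
    show "h > 0" by (rule h)
    have N: "heis_norm (X, Y, T) = sqrt (X\<^sup>2 + Y\<^sup>2) * (\<theta> / sin \<theta>)" by (rule heis_norm_chord(1)[OF \<theta>])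
    have "1 \<le> u / sin u"
      using u sin_x_le_x[of "\<bar>u\<bar>"] sin_gt_zero[of "\<bar>u\<bar>"] us
      by (auto simp: abs_if le_divide_eq split: if_splits)
    \<comment> \<open>By the double angle formula. The resulting lower bound 1 makes
      \<open>h\<close> an upper bound for the ratio of the horizontal part to the norm.\<close>
    have "\<theta> / sin \<theta> * h = (u / sin u)\<^sup>2"
      unfolding \<theta>u sin_double h_def cot_def using s0 c by (simp add: field_simps power2_eq_square)
    also have "\<dots> \<ge> 1" using \<open>1 \<le> u / sin u\<close> by (rule one_le_power)
    finally have "1 \<le> \<theta> / sin \<theta> * h" .
    then have "sqrt (X\<^sup>2 + Y\<^sup>2) * 1 \<le> sqrt (X\<^sup>2 + Y\<^sup>2) * (\<theta> / sin \<theta> * h)" by (intro mult_left_mono) auto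
    then show "sqrt (X\<^sup>2 + Y\<^sup>2) \<le> heis_norm (X, Y, T) * h" unfolding N by (simp add: mult.assoc)
    have "\<theta> * cot \<theta> = h - \<theta>\<^sup>2 / (4 * h)"
    proof -
      have "cot \<theta> = ((cos u)\<^sup>2 - (sin u)\<^sup>2) / (2 * sin u * cos u)"
        by (simp add: \<theta>u cot_def sin_double cos_double)
      then show ?thesis
        unfolding \<open>cot \<theta> = _\<close> unfolding h_def cot_def \<theta>u using s0 c u
        by (simp add: field_simps power2_eq_square)
    qed
    then show "(heis_norm (X, Y, T))\<^sup>2 = \<theta> * T + (X\<^sup>2 + Y\<^sup>2) * (h - \<theta>\<^sup>2 / (4 * h))"
      using heis_norm_chord(2)[OF \<theta>] by (simp add: mult.commute)
    show "(\<theta> / 2) * t + h * (x\<^sup>2 + y\<^sup>2) \<le> (heis_norm (x, y, t))\<^sup>2" for x y t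
      using heis_norm_lower[of u t x y] u by (simp add: u_def h_def)
  qed
qed

section \<open>Approximate midpoints\<close>

lemma heis_dist_coords:
  "heis_dist (x, y, t) (x', y', t') = heis_norm (x' - x, y' - y, t' - t + 2 * (x * y' - x' * y))"
  by (subst heis_dist_translate) (simp add: heis_mult_def heis_inv_def algebra_simps)

text \<open>The centre and \<open>h\<close> depend only on the endpoint, not on the point
  \<open>(x, y, t)\<close> or on \<open>M\<close>. So the planar parts of all approximate midpoints
  lie in one disc whose radius is governed by the defect \<open>4 * M^2 - N^2\<close>, with
  \<open>N\<close> the norm of the endpoint.\<close>

lemma midpoint_concentration:
  assumes "X\<^sup>2 + Y\<^sup>2 > 0"
  obtains h cx cy where "h > 0" "sqrt (X\<^sup>2 + Y\<^sup>2) \<le> heis_norm (X, Y, T) * h"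
    "\<And>x y t M. heis_norm (x, y, t) \<le> M \<Longrightarrow> heis_dist (x, y, t) (X, Y, T) \<le> M \<Longrightarrow>
       4 * h * ((x - cx)\<^sup>2 + (y - cy)\<^sup>2) \<le> 4 * M\<^sup>2 - (heis_norm (X, Y, T))\<^sup>2"
proof -
  obtain \<theta> h where h: "h > 0" "sqrt (X\<^sup>2 + Y\<^sup>2) \<le> heis_norm (X, Y, T) * h"
    and N: "(heis_norm (X, Y, T))\<^sup>2 = \<theta> * T + (X\<^sup>2 + Y\<^sup>2) * (h - \<theta>\<^sup>2 / (4 * h))"
    and low: "\<And>x y t. (\<theta> / 2) * t + h * (x\<^sup>2 + y\<^sup>2) \<le> (heis_norm (x, y, t))\<^sup>2"
    by (rule heis_norm_half_angle[OF assms, of T]) (rule that)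
  \<comment> \<open>The centre of the completed square: the midpoint of the chord moved
    perpendicularly to it by \<open>k\<close> times the chord. As
    \<open>k = tan (\<theta> / 2) / 2\<close>, it is the midpoint of the projected arc.\<close>
  define k cx cy where "k = \<theta> / (4 * h)" and "cx = X / 2 - k * Y" and "cy = Y / 2 + k * X"
  have \<theta>: "\<theta> = 4 * h * k" using h by (simp add: k_def)
  have double: "2 * (u + v) \<le> 4 * m" if "u \<le> m" "v \<le> m" for u v m :: real using that by simp
  show ?thesis
  proof (rule that[of h cx cy, OF h])
    fix x y t M assume M: "heis_norm (x, y, t) \<le> M" "heis_dist (x, y, t) (X, Y, T) \<le> M"
    have "(\<theta> / 2) * t + h * (x\<^sup>2 + y\<^sup>2) \<le> M\<^sup>2"
      using low[of t x y] power_mono[OF M(1) heis_norm_nonneg, of 2] by linarith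
    moreover have "(\<theta> / 2) * (T - t + 2 * (x * Y - X * y)) + h * ((X - x)\<^sup>2 + (Y - y)\<^sup>2) \<le> M\<^sup>2"
      using low[of "T - t + 2 * (x * Y - X * y)" "X - x" "Y - y"]
        power_mono[OF M(2)[unfolded heis_dist_coords] heis_norm_nonneg, of 2] by linarith
    ultimately have "2 * ((\<theta> / 2) * t + h * (x\<^sup>2 + y\<^sup>2) +
        ((\<theta> / 2) * (T - t + 2 * (x * Y - X * y)) + h * ((X - x)\<^sup>2 + (Y - y)\<^sup>2))) \<le> 4 * M\<^sup>2"
      by (rule double)
    moreover have "2 * ((\<theta> / 2) * t + h * (x\<^sup>2 + y\<^sup>2) +
        ((\<theta> / 2) * (T - t + 2 * (x * Y - X * y)) + h * ((X - x)\<^sup>2 + (Y - y)\<^sup>2)))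
        = \<theta> * T + (X\<^sup>2 + Y\<^sup>2) * (h - \<theta> * k) + 4 * h * ((x - cx)\<^sup>2 + (y - cy)\<^sup>2)"
      unfolding cx_def cy_def \<theta> by (simp add: power2_eq_square field_simps)
    moreover have "\<theta>\<^sup>2 / (4 * h) = \<theta> * k" by (simp add: k_def power2_eq_square)
    ultimately show "4 * h * ((x - cx)\<^sup>2 + (y - cy)\<^sup>2) \<le> 4 * M\<^sup>2 - (heis_norm (X, Y, T))\<^sup>2"
      unfolding N by simp
  qed
qed

text \<open>On a vertical line the square of the distance is additive, so three points that are nearly on
  such a line are not nearly equidistant.\<close>
lemma equidistant_triple_not_vertical:
  fixes x y t :: "nat \<Rightarrow> real"
  defines "P \<equiv> \<lambda>i. (x i, y i, t i)"
  assumes "\<delta> > 0"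
    and lower: "\<And>i j. (i, j) \<in> {(0, 1), (1, 2), (2, 0)} \<Longrightarrow> 99 / 100 * \<delta> \<le> heis_dist (P i) (P j)"
    and upper: "\<And>i j. (i, j) \<in> {(0, 1), (1, 2), (2, 0)} \<Longrightarrow> heis_dist (P i) (P j) \<le> 101 / 100 * \<delta>"
    and near: "\<And>i j. (i, j) \<in> {(0, 1), (1, 2), (2, 0)} \<Longrightarrow> (x j - x i)\<^sup>2 + (y j - y i)\<^sup>2 \<le> (\<delta> / 100)\<^sup>2"
  shows False
proof -
  \<comment> \<open>The vertical coordinate of the group quotient of \<open>P j\<close> by
    \<open>P i\<close>.\<close>
  define w where "w i j = t j - t i + 2 * (x i * y j - x j * y i)" for i j
  have w: "96 / 100 * \<delta>\<^sup>2 \<le> pi * \<bar>w i j\<bar> \<and> pi * \<bar>w i j\<bar> \<le> 107 / 100 * \<delta>\<^sup>2"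
    if ij: "(i, j) \<in> {(0, 1), (1, 2), (2, 0)}" for i j
  proof -
    define a where "a = sqrt (pi * \<bar>w i j\<bar>)"
    have a2: "a\<^sup>2 = pi * \<bar>w i j\<bar>" and a0: "a \<ge> 0" by (auto simp: a_def)
    have q: "sqrt ((x j - x i)\<^sup>2 + (y j - y i)\<^sup>2) \<le> \<delta> / 100"
      using near[OF ij] \<open>\<delta> > 0\<close> by (intro real_le_lsqrt) auto
    have eq: "heis_dist (P i) (P j) = heis_norm (x j - x i, y j - y i, w i j)"
      by (simp add: P_def heis_dist_coords w_def)
    \<comment> \<open>The norm lies between \<open>a - 2 * q\<close> and \<open>a + q\<close> with a
      horizontal part \<open>q\<close> of at most \<open>\<delta> / 100\<close>.\<close>
    have "98 / 100 * \<delta> \<le> a" "a \<le> 103 / 100 * \<delta>"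
      using heis_norm_le[of "x j - x i" "y j - y i" "w i j"] heis_norm_ge[of "w i j" "x j - x i" "y j - y i"]
        lower[OF ij] upper[OF ij] q unfolding eq a_def by linarith+
    then have "(98 / 100 * \<delta>)\<^sup>2 \<le> a\<^sup>2" "a\<^sup>2 \<le> (103 / 100 * \<delta>)\<^sup>2"
      using \<open>\<delta> > 0\<close> a0 by (auto intro!: power_mono)
    then have "(98 / 100)\<^sup>2 * \<delta>\<^sup>2 \<le> a\<^sup>2" "a\<^sup>2 \<le> (103 / 100)\<^sup>2 * \<delta>\<^sup>2" by (simp_all only: power_mult_distrib)
    moreover have "96 / 100 * \<delta>\<^sup>2 \<le> (98 / 100)\<^sup>2 * \<delta>\<^sup>2" "(103 / 100)\<^sup>2 * \<delta>\<^sup>2 \<le> 107 / 100 * \<delta>\<^sup>2"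
      by (intro mult_right_mono; simp add: power2_eq_square)+
    ultimately show ?thesis unfolding a2 by linarith
  qed
  define p1 p2 q1 q2 where "p1 = x 1 - x 0" and "p2 = y 1 - y 0" and "q1 = x 0 - x 2" and "q2 = y 0 - y 2"
  \<comment> \<open>Around the cycle the heights cancel, and four times the signed area of the small
    planar triangle remains.\<close>
  have "w 0 1 + w 1 2 + w 2 0 = 2 * (q1 * p2 - p1 * q2)"
    by (simp add: w_def p1_def p2_def q1_def q2_def algebra_simps)
  moreover have "\<bar>2 * (q1 * p2 - p1 * q2)\<bar> \<le> (p1\<^sup>2 + p2\<^sup>2) + (q1\<^sup>2 + q2\<^sup>2)"
    using zero_le_power2[of "q1 - p2"] zero_le_power2[of "q1 + p2"]
      zero_le_power2[of "p1 - q2"] zero_le_power2[of "p1 + q2"]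
    unfolding power2_diff power2_sum abs_le_iff by (simp add: algebra_simps)
  moreover have "\<dots> \<le> 2 * (\<delta> / 100)\<^sup>2"
    using near[of 0 1] near[of 2 0] by (simp add: p1_def p2_def q1_def q2_def)
  ultimately have "\<bar>w 0 1 + w 1 2 + w 2 0\<bar> \<le> 2 * (\<delta> / 100)\<^sup>2" by linarith
  then have "pi * \<bar>w 0 1 + w 1 2 + w 2 0\<bar> \<le> 4 * (2 * (\<delta> / 100)\<^sup>2)"
    using pi_less_4 by (intro mult_mono) auto
  also have "\<dots> \<le> 1 / 100 * \<delta>\<^sup>2" by (simp add: power_divide)
  finally have "pi * \<bar>w 0 1 + w 1 2 + w 2 0\<bar> \<le> 1 / 100 * \<delta>\<^sup>2" .
  then have "\<bar>pi * w 0 1 + pi * w 1 2 + pi * w 2 0\<bar> \<le> 1 / 100 * \<delta>\<^sup>2"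
    by (simp add: abs_mult flip: distrib_left)
  moreover have "96 / 100 * \<delta>\<^sup>2 \<le> \<bar>pi * w i j\<bar> \<and> \<bar>pi * w i j\<bar> \<le> 107 / 100 * \<delta>\<^sup>2"
    if "(i, j) \<in> {(0, 1), (1, 2), (2, 0)}" for i j
    using w[OF that] by (simp add: abs_mult)
  note this[of 0 1] this[of 1 2] this[of 2 0]
  moreover have "\<delta>\<^sup>2 > 0" using \<open>\<delta> > 0\<close> by simp
  \<comment> \<open>Whatever the signs, three such numbers have a sum of modulus at least
    \<open>2 * 0.96 * d - 1.07 * d\<close>.\<close>
  moreover have False if "96 / 100 * d \<le> \<bar>u\<bar> \<and> \<bar>u\<bar> \<le> 107 / 100 * d"
      "96 / 100 * d \<le> \<bar>v\<bar> \<and> \<bar>v\<bar> \<le> 107 / 100 * d" "96 / 100 * d \<le> \<bar>z\<bar> \<and> \<bar>z\<bar> \<le> 107 / 100 * d"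
      "\<bar>u + v + z\<bar> \<le> 1 / 100 * d" "d > 0" for u v z d :: real
    using that by (auto simp: abs_if split: if_splits)
  ultimately show False by blast
qed

text \<open>Half of the full circle that represents a vertical geodesic is a semicircle, with
  \<open>\<theta> = \<plusminus> pi / 2\<close> and diameter \<open>sqrt (|T| / pi)\<close>;
  rotating it gives the whole circle of midpoints.\<close>

lemma vertical_midpoint:
  assumes "x\<^sup>2 + y\<^sup>2 = \<bar>T\<bar> / pi" "T \<noteq> 0"
  shows "heis_norm (x, y, T / 2) \<le> sqrt (pi * \<bar>T\<bar>) / 2"
    "heis_dist (x, y, T / 2) (0, 0, T) \<le> sqrt (pi * \<bar>T\<bar>) / 2"
proof -
  have *: "heis_norm (x, y, T / 2) \<le> sqrt (pi * \<bar>T\<bar>) / 2" if "x\<^sup>2 + y\<^sup>2 = \<bar>T\<bar> / pi" for x y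
  proof -
    define \<theta> where "\<theta> = (if T > 0 then pi / 2 else - pi / 2)"
    have \<theta>: "0 < \<bar>\<theta>\<bar>" "\<bar>\<theta>\<bar> < pi" "(sin \<theta>)\<^sup>2 = 1" "cos \<theta> = 0" "\<theta> / sin \<theta> = pi / 2" by (auto simp: \<theta>_def)
    have "T / 2 * (sin \<theta>)\<^sup>2 = (x\<^sup>2 + y\<^sup>2) * (\<theta> - sin \<theta> * cos \<theta>)"
      using assms(2) by (simp add: that \<theta>(3,4)) (simp add: \<theta>_def)
    then have "heis_norm (x, y, T / 2) = sqrt (\<bar>T\<bar> / pi) * (pi / 2)"
      using heis_norm_chord(1)[OF \<theta>(1,2)] by (simp add: that \<theta>(5))
    moreover have "sqrt (\<bar>T\<bar> / pi) * pi = sqrt (\<bar>T\<bar> / pi * pi\<^sup>2)" by (subst real_sqrt_mult) simp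
    ultimately show ?thesis by (simp add: power2_eq_square mult.commute)
  qed
  show "heis_norm (x, y, T / 2) \<le> sqrt (pi * \<bar>T\<bar>) / 2" by (rule *[OF assms(1)])
  show "heis_dist (x, y, T / 2) (0, 0, T) \<le> sqrt (pi * \<bar>T\<bar>) / 2"
    using *[of "- x" "- y"] assms(1) by (simp add: heis_dist_coords)
qed

section \<open>Images of points of the vertical axis\<close>

lemma heis_bilipschitzD:
  assumes "heis_bilipschitz (1 + \<epsilon>) f" "0 < \<epsilon>"
  shows "heis_dist P Q \<le> (1 + \<epsilon>) * heis_dist (f P) (f Q)" "heis_dist (f P) (f Q) \<le> (1 + \<epsilon>) * heis_dist P Q"
proof -
  have "inverse (1 + \<epsilon>) * heis_dist P Q \<le> heis_dist (f P) (f Q)"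
    using assms(1) unfolding heis_bilipschitz_def by blast
  then show "heis_dist P Q \<le> (1 + \<epsilon>) * heis_dist (f P) (f Q)"
    using assms(2) by (simp add: field_simps)
  show "heis_dist (f P) (f Q) \<le> (1 + \<epsilon>) * heis_dist P Q"
    using assms(1) unfolding heis_bilipschitz_def by blast
qed

text \<open>Images of midpoints are approximate midpoints of 0 and \<open>Q\<close>, so their planar
  parts concentrate if \<open>h\<close> is large compared with \<open>\<epsilon>\<close>. For three
  images this contradicts \<open>equidistant_triple_not_vertical\<close>. Hence
  \<open>h \<le> 300000 * \<epsilon>\<close>, and the horizontal part of \<open>Q\<close> is at most
  its norm times \<open>h\<close>.\<close>

lemma vertical_image_horizontal_part:
  assumes \<epsilon>: "0 < \<epsilon>" "\<epsilon> \<le> 1 / 100" and f: "heis_bilipschitz (1 + \<epsilon>) f" "f 0 = 0"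
    and fT: "f (0, 0, T) = (X, Y, S)"
  shows "sqrt (X\<^sup>2 + Y\<^sup>2) \<le> 400000 * \<epsilon> * sqrt (pi * \<bar>T\<bar>)"
proof (cases "X\<^sup>2 + Y\<^sup>2 > 0")
  case False
  then have "X\<^sup>2 + Y\<^sup>2 = 0" using sum_power2_ge_zero[of X Y] by linarith
  then have "sqrt (X\<^sup>2 + Y\<^sup>2) = 0" by simp
  then show ?thesis using \<epsilon> by simp
next
  case True
  note lip = heis_bilipschitzD[OF f(1) \<epsilon>(1)]
  have "T \<noteq> 0"
  proof
    assume "T = 0"
    then have "f (0, 0, T) = 0" using f(2) by (simp add: zero_prod_def)
    then show False using True fT by (simp add: zero_prod_def)
  qed
  define D r where "D = sqrt (pi * \<bar>T\<bar>)" and "r = sqrt (\<bar>T\<bar> / pi)"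
  have D: "D > 0" using \<open>T \<noteq> 0\<close> by (simp add: D_def)
  have "D = sqrt (\<bar>T\<bar> / pi * pi\<^sup>2)" by (simp add: D_def power2_eq_square mult.commute)
  also have "\<dots> = r * pi" unfolding r_def by (subst real_sqrt_mult) simp
  finally have Dr: "D = r * pi" .
  have r: "r > 0" "r\<^sup>2 = \<bar>T\<bar> / pi" using \<open>T \<noteq> 0\<close> by (auto simp: r_def)
  define Q where "Q = (X, Y, S)"
  have ND: "heis_norm (0, 0, T) = D" by (simp add: heis_norm_vertical D_def)
  have Q: "D \<le> (1 + \<epsilon>) * heis_norm Q" "heis_norm Q \<le> (1 + \<epsilon>) * D"
    using lip[of 0 "(0, 0, T)"] by (simp_all add: f(2) fT ND Q_def)
  obtain h cx cy where h: "h > 0" "sqrt (X\<^sup>2 + Y\<^sup>2) \<le> heis_norm Q * h"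
    and conc: "\<And>x y t M. heis_norm (x, y, t) \<le> M \<Longrightarrow> heis_dist (x, y, t) Q \<le> M \<Longrightarrow>
       4 * h * ((x - cx)\<^sup>2 + (y - cy)\<^sup>2) \<le> 4 * M\<^sup>2 - (heis_norm Q)\<^sup>2"
    by (rule midpoint_concentration[OF True, of S, folded Q_def]) (rule that)

  \<comment> \<open>An equilateral triangle inscribed in the circle of midpoints; index 2 falls
    under the last branch.\<close>
  define mx my where "mx i = (if i = 0 then r else - r / 2)"
    and "my i = (if i = 0 then 0 else if i = 1 then sqrt 3 / 2 * r else - (sqrt 3 / 2 * r))" for i :: nat
  define m where "m i = (mx i, my i, T / 2)" for i
  have s3: "sqrt 3 * sqrt 3 = (3::real)" by simp
  have mr: "(mx i)\<^sup>2 + (my i)\<^sup>2 = \<bar>T\<bar> / pi" for i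
    unfolding r(2)[symmetric] by (simp add: mx_def my_def power2_eq_square s3 field_simps)
  \<comment> \<open>The common side length: planar side \<open>sqrt 3 * r\<close> and relative
    height \<open>sqrt 3 * r^2\<close>. The three sides are taken in cyclic order so that this
    height has the same sign for each.\<close>
  define \<delta> where "\<delta> = heis_norm (sqrt 3 * r, 0, sqrt 3 * r\<^sup>2)"
  have md: "heis_dist (m i) (m j) = \<delta>" if "(i, j) \<in> {(0, 1), (1, 2), (2, 0)}" for i j
  proof -
    have "(mx j - mx i)\<^sup>2 + (my j - my i)\<^sup>2 = (sqrt 3 * r)\<^sup>2 + 0\<^sup>2"
      "2 * (mx i * my j - mx j * my i) = sqrt 3 * r\<^sup>2"
      using that s3 by (auto simp: mx_def my_def power2_eq_square field_simps)
    then show ?thesis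
      unfolding m_def \<delta>_def heis_dist_coords using heis_norm_cong by simp
  qed
  have "(sqrt 3 * r)\<^sup>2 \<le> \<delta>\<^sup>2"
    using heis_norm_ge_horizontal[of "sqrt 3 * r" 0 "sqrt 3 * r\<^sup>2"] by (simp add: \<delta>_def)
  then have "3 * r\<^sup>2 \<le> \<delta>\<^sup>2" by (simp add: power_mult_distrib)
  \<comment> \<open>\<open>D = r * pi \<le> 4 * r\<close> gives
    \<open>D^2 \<le> 16 * r^2 \<le> 6 * (3 * r^2)\<close>, which relates the scale \<open>D\<close>
    to the side \<open>\<delta>\<close>.\<close>
  moreover have "D\<^sup>2 \<le> (4 * r)\<^sup>2" unfolding Dr using r(1) pi_less_4 by (intro power_mono) auto
  then have "D\<^sup>2 \<le> 16 * r\<^sup>2" by (simp add: power_mult_distrib)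
  ultimately have D\<delta>: "D\<^sup>2 \<le> 6 * \<delta>\<^sup>2" using zero_le_power2[of r] by linarith
  have "\<delta> \<noteq> 0" using D\<delta> D by auto
  then have \<delta>: "\<delta> > 0" using heis_norm_nonneg by (simp add: \<delta>_def order.strict_iff_order)

  define px py pt where "px i = fst (f (m i))" and "py i = fst (snd (f (m i)))" and "pt i = snd (snd (f (m i)))" for i
  have P: "f (m i) = (px i, py i, pt i)" for i by (simp add: px_def py_def pt_def)
  \<comment> \<open>Bounds the distances from each image to both 0 and \<open>Q\<close>, since the
    midpoints are at distance at most \<open>D / 2\<close> from both ends.\<close>
  define M where "M = (1 + \<epsilon>) * (D / 2)"
  have "heis_norm (px i, py i, pt i) \<le> M" "heis_dist (px i, py i, pt i) Q \<le> M" for i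
  proof -
    have "heis_norm (m i) \<le> D / 2" "heis_dist (m i) (0, 0, T) \<le> D / 2"
      using vertical_midpoint[OF mr \<open>T \<noteq> 0\<close>] by (auto simp: m_def D_def)
    then have "(1 + \<epsilon>) * heis_norm (m i) \<le> M" "(1 + \<epsilon>) * heis_dist (m i) (0, 0, T) \<le> M"
      unfolding M_def using \<epsilon> by (auto intro!: mult_left_mono)
    then show "heis_norm (px i, py i, pt i) \<le> M" "heis_dist (px i, py i, pt i) Q \<le> M"
      using lip(2)[of 0 "m i"] lip(2)[of "m i" "(0, 0, T)"] unfolding f(2) fT P Q_def by linarith+
  qed
  note conc' = conc[OF this]
  \<comment> \<open>The norm of \<open>Q\<close> is at least \<open>(1 - \<epsilon>) * D\<close>, so
    the defect is at most \<open>((1 + \<epsilon>)^2 - (1 - \<epsilon>)^2) * D^2 = 4 * \<epsilon> *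
    D^2\<close>.\<close>
  have "4 * M\<^sup>2 - (heis_norm Q)\<^sup>2 \<le> 5 * \<epsilon> * D\<^sup>2"
  proof -
    have "((1 - \<epsilon>) * D) * (1 + \<epsilon>) \<le> D" using D \<epsilon> by (simp add: algebra_simps)
    then have "((1 - \<epsilon>) * D) * (1 + \<epsilon>) \<le> heis_norm Q * (1 + \<epsilon>)" using Q(1) by (simp add: mult.commute)
    then have "(1 - \<epsilon>) * D \<le> heis_norm Q" using \<epsilon> by simp
    then have "((1 - \<epsilon>) * D)\<^sup>2 \<le> (heis_norm Q)\<^sup>2" using \<epsilon> D by (intro power_mono) auto
    moreover have "4 * M\<^sup>2 = (1 + \<epsilon>)\<^sup>2 * D\<^sup>2" by (simp add: M_def power_mult_distrib power_divide)
    moreover have "(1 + \<epsilon>)\<^sup>2 * D\<^sup>2 - ((1 - \<epsilon>) * D)\<^sup>2 = 4 * \<epsilon> * D\<^sup>2"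
      by (simp add: power2_eq_square algebra_simps)
    moreover have "4 * \<epsilon> * D\<^sup>2 \<le> 5 * \<epsilon> * D\<^sup>2" using \<epsilon> by simp
    ultimately show ?thesis by linarith
  qed
  then have conc'': "4 * h * ((px i - cx)\<^sup>2 + (py i - cy)\<^sup>2) \<le> 5 * \<epsilon> * D\<^sup>2" for i
    using conc'[of i] by linarith
  have spread: "h * ((px j - px i)\<^sup>2 + (py j - py i)\<^sup>2) \<le> 5 * \<epsilon> * D\<^sup>2" for i j
  proof -
    have *: "(u - v)\<^sup>2 \<le> 2 * (u - c)\<^sup>2 + 2 * (v - c)\<^sup>2" for u v c :: real
      using zero_le_power2[of "u + v - 2 * c"] by (simp add: power2_eq_square algebra_simps)
    have avg: "(u + v) / 2 \<le> c" if "u \<le> c" "v \<le> c" for u v c :: real using that by simp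
    have "h * ((px j - px i)\<^sup>2 + (py j - py i)\<^sup>2) \<le>
        h * ((2 * (px j - cx)\<^sup>2 + 2 * (px i - cx)\<^sup>2) + (2 * (py j - cy)\<^sup>2 + 2 * (py i - cy)\<^sup>2))"
      using h(1) by (intro mult_left_mono add_mono *) auto
    also have "\<dots> = (4 * h * ((px j - cx)\<^sup>2 + (py j - cy)\<^sup>2) + 4 * h * ((px i - cx)\<^sup>2 + (py i - cy)\<^sup>2)) / 2"
      by (simp add: field_simps)
    also have "\<dots> \<le> 5 * \<epsilon> * D\<^sup>2" by (rule avg[OF conc'' conc''])
    finally show ?thesis .
  qed
  \<comment> \<open>The constant is \<open>5 * 6 * 100^2\<close>: a larger \<open>h\<close> would
    bring the planar parts within \<open>\<delta> / 100\<close> of each other.\<close>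
  have "h \<le> 300000 * \<epsilon>"
  proof (rule ccontr)
    assume "\<not> h \<le> 300000 * \<epsilon>"
    then have big: "300000 * \<epsilon> \<le> h" by simp
    show False
    proof (rule equidistant_triple_not_vertical[OF \<delta>, of px py pt])
      fix i j :: nat assume ij: "(i, j) \<in> {(0, 1), (1, 2), (2, 0)}"
      have l: "\<delta> \<le> (1 + \<epsilon>) * heis_dist (f (m i)) (f (m j))" "heis_dist (f (m i)) (f (m j)) \<le> (1 + \<epsilon>) * \<delta>"
        using lip[of "m i" "m j"] md[OF ij] by auto
      have e: "(1 + \<epsilon>) * \<delta> \<le> 101 / 100 * \<delta>" using \<epsilon> \<delta> by (intro mult_right_mono) auto
      then show "heis_dist (px i, py i, pt i) (px j, py j, pt j) \<le> 101 / 100 * \<delta>"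
        using l(2) unfolding P by linarith
      have "heis_dist (f (m i)) (f (m j)) \<ge> 0"
        by (subst heis_dist_translate) (rule heis_norm_nonneg)
      then have "(1 + \<epsilon>) * heis_dist (f (m i)) (f (m j)) \<le> 101 / 100 * heis_dist (f (m i)) (f (m j))"
        using \<epsilon> by (intro mult_right_mono) auto
      then show "99 / 100 * \<delta> \<le> heis_dist (px i, py i, pt i) (px j, py j, pt j)"
        using l(1) \<delta> unfolding P by linarith
      have "300000 * \<epsilon> * ((px j - px i)\<^sup>2 + (py j - py i)\<^sup>2) \<le> h * ((px j - px i)\<^sup>2 + (py j - py i)\<^sup>2)"
        using big by (intro mult_right_mono) auto
      also have "\<dots> \<le> 5 * \<epsilon> * D\<^sup>2" by (rule spread)
      also have "\<dots> \<le> 5 * \<epsilon> * (6 * \<delta>\<^sup>2)" using D\<delta> \<epsilon> by (intro mult_left_mono) auto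
      also have "\<dots> = 300000 * \<epsilon> * (\<delta> / 100)\<^sup>2" by (simp add: power_divide)
      finally show "(px j - px i)\<^sup>2 + (py j - py i)\<^sup>2 \<le> (\<delta> / 100)\<^sup>2" using \<epsilon>(1) by simp
    qed
  qed
  then have "heis_norm Q * h \<le> ((1 + \<epsilon>) * D) * (300000 * \<epsilon>)"
    using Q(2) h(1) \<epsilon> D by (intro mult_mono) auto
  also have "\<dots> = (1 + \<epsilon>) * (300000 * (\<epsilon> * D))" by (simp add: algebra_simps)
  also have "\<dots> \<le> (4 / 3) * (300000 * (\<epsilon> * D))" using \<epsilon> D by (intro mult_right_mono) auto
  finally show ?thesis using h(2) by (simp add: D_def mult.assoc)
qed

text \<open>Since the horizontal part is small, the norm of the image is close to
  \<open>sqrt (pi * |S|)\<close> and, by the biLipschitz bound, also to \<open>D\<close>. Factoring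
  the difference of the squares turns this into a bound for the heights.\<close>

lemma vertical_image_vertical_part:
  assumes \<epsilon>: "0 < \<epsilon>" "\<epsilon> \<le> 1 / 10 ^ 9" and f: "heis_bilipschitz (1 + \<epsilon>) f" "f 0 = 0"
    and fT: "f (0, 0, T) = (X, Y, S)"
  shows "\<bar>\<bar>S\<bar> - \<bar>T\<bar>\<bar> \<le> 3000000 * \<epsilon> * \<bar>T\<bar>"
proof -
  define D a q where "D = sqrt (pi * \<bar>T\<bar>)" and "a = sqrt (pi * \<bar>S\<bar>)" and "q = sqrt (X\<^sup>2 + Y\<^sup>2)"
  have D: "D \<ge> 0" "D\<^sup>2 = pi * \<bar>T\<bar>" and a: "a \<ge> 0" "a\<^sup>2 = pi * \<bar>S\<bar>" by (auto simp: D_def a_def)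
  have \<epsilon>': "\<epsilon> \<le> 1 / 100" using \<epsilon>(2) by simp
  have q: "q \<le> 400000 * \<epsilon> * D"
    unfolding q_def D_def by (rule vertical_image_horizontal_part[OF \<epsilon>(1) \<epsilon>' f fT])
  have ND: "heis_norm (0, 0, T) = D" by (simp add: heis_norm_vertical D_def)
  define N where "N = heis_norm (X, Y, S)"
  have Q: "D \<le> (1 + \<epsilon>) * N" "N \<le> (1 + \<epsilon>) * D"
    using heis_bilipschitzD[OF f(1) \<epsilon>(1), of 0 "(0, 0, T)"] by (simp_all add: f(2) fT ND N_def)
  have Na: "N \<le> q + a" "a - 2 * q \<le> N"
    using heis_norm_le[of X Y S] heis_norm_ge[of S X Y] by (auto simp: N_def a_def q_def)
  define e where "e = \<epsilon> * D"
  have e0: "e \<ge> 0" using \<epsilon> D by (simp add: e_def)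
  have "\<epsilon> * N \<le> \<epsilon> * (2 * D)"
  proof (rule mult_left_mono)
    have "(1 + \<epsilon>) * D \<le> 2 * D" using \<epsilon>' D by (intro mult_right_mono) auto
    then show "N \<le> 2 * D" using Q(2) by linarith
  qed (use \<epsilon> in simp)
  then have "D - 2 * e \<le> N" "N \<le> D + e" using Q by (auto simp: e_def algebra_simps)
  \<comment> \<open>The worst case is the upper bound for \<open>a\<close>: \<open>e\<close> from
    the distortion and \<open>2 * 400000 * e\<close> from the horizontal part.\<close>
  then have "\<bar>a - D\<bar> \<le> 900000 * e" using Na q e0 by (simp add: e_def abs_le_iff)
  moreover have "a + D \<le> 3 * D"
  proof -
    \<comment> \<open>Here the smallness of \<open>\<epsilon>\<close> enters, giving
      \<open>a \<le> 2 * D\<close>.\<close>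
    have "900000 * e \<le> 1 * D" unfolding e_def mult.assoc[symmetric] using \<epsilon> D by (intro mult_right_mono) auto
    then show ?thesis using calculation by (simp add: abs_le_iff)
  qed
  ultimately have "\<bar>a - D\<bar> * (a + D) \<le> (900000 * e) * (3 * D)"
    using a D e0 by (intro mult_mono) auto
  moreover have "\<bar>a - D\<bar> * (a + D) = \<bar>(a - D) * (a + D)\<bar>" using a D by (simp add: abs_mult)
  moreover have "(a - D) * (a + D) = pi * (\<bar>S\<bar> - \<bar>T\<bar>)"
    unfolding right_diff_distrib a(2)[symmetric] D(2)[symmetric] by (simp add: power2_eq_square algebra_simps)
  moreover have "(900000 * e) * (3 * D) = pi * (2700000 * \<epsilon> * \<bar>T\<bar>)"
    using D(2) by (simp add: e_def power2_eq_square algebra_simps)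
  ultimately have "pi * \<bar>\<bar>S\<bar> - \<bar>T\<bar>\<bar> \<le> pi * (2700000 * \<epsilon> * \<bar>T\<bar>)" by (simp add: abs_mult)
  then have "\<bar>\<bar>S\<bar> - \<bar>T\<bar>\<bar> \<le> 2700000 * \<epsilon> * \<bar>T\<bar>" by simp
  also have "\<dots> \<le> 3000000 * \<epsilon> * \<bar>T\<bar>" using \<epsilon>(1) by (intro mult_right_mono) auto
  finally show ?thesis .
qed

section \<open>The sign of the height along the vertical axis\<close>

lemma near_vertical_dist:
  fixes X Y S X' Y' S' D :: real
  assumes "D \<ge> 0" "sqrt (X\<^sup>2 + Y\<^sup>2) \<le> D / 1000" "sqrt (X'\<^sup>2 + Y'\<^sup>2) \<le> D / 1000"
  obtains w where "pi * \<bar>w - (S' - S)\<bar> \<le> D\<^sup>2 / 100"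
    "sqrt (pi * \<bar>w\<bar>) - D / 200 \<le> heis_dist (X, Y, S) (X', Y', S')"
    "heis_dist (X, Y, S) (X', Y', S') \<le> sqrt (pi * \<bar>w\<bar>) + D / 200"
proof -
  have sq: "X\<^sup>2 + Y\<^sup>2 \<le> (D / 1000)\<^sup>2" "X'\<^sup>2 + Y'\<^sup>2 \<le> (D / 1000)\<^sup>2"
    by (rule sqrt_le_D[OF assms(2)], rule sqrt_le_D[OF assms(3)])
  have cross: "\<bar>2 * (X * Y' - X' * Y)\<bar> \<le> (X\<^sup>2 + Y\<^sup>2) + (X'\<^sup>2 + Y'\<^sup>2)"
    using zero_le_power2[of "X - Y'"] zero_le_power2[of "X + Y'"]
      zero_le_power2[of "X' - Y"] zero_le_power2[of "X' + Y"]
    unfolding power2_diff power2_sum abs_le_iff by (simp add: algebra_simps)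
  have "(X' - X)\<^sup>2 + (Y' - Y)\<^sup>2 \<le> 2 * (X\<^sup>2 + Y\<^sup>2) + 2 * (X'\<^sup>2 + Y'\<^sup>2)"
    using zero_le_power2[of "X + X'"] zero_le_power2[of "Y + Y'"]
    by (simp add: power2_eq_square algebra_simps)
  also have "\<dots> \<le> (D / 500)\<^sup>2" using sq by (simp add: power_divide)
  finally have q: "sqrt ((X' - X)\<^sup>2 + (Y' - Y)\<^sup>2) \<le> D / 500" using assms(1) by (intro real_le_lsqrt) auto
  \<comment> \<open>The relative height of the two points; it differs from \<open>S' - S\<close> by
    a twist that is quadratic in the small horizontal parts.\<close>
  define w where "w = S' - S + 2 * (X * Y' - X' * Y)"
  have "\<bar>w - (S' - S)\<bar> \<le> 2 * (D / 1000)\<^sup>2" using cross sq by (simp add: w_def)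
  then have "pi * \<bar>w - (S' - S)\<bar> \<le> 4 * (2 * (D / 1000)\<^sup>2)" using pi_less_4 by (intro mult_mono) auto
  also have "\<dots> \<le> D\<^sup>2 / 100" by (simp add: power_divide)
  finally have 1: "pi * \<bar>w - (S' - S)\<bar> \<le> D\<^sup>2 / 100" .
  show ?thesis
    by (rule that[of w, OF 1])
      (use heis_norm_le[of "X' - X" "Y' - Y" w] heis_norm_ge[of w "X' - X" "Y' - Y"] q assms(1)
        in \<open>auto simp: heis_dist_coords w_def\<close>)
qed

lemma vertical_dist: "heis_dist (0, 0, T) (0, 0, T') = sqrt (pi * \<bar>T' - T\<bar>)"
  by (simp add: heis_dist_coords heis_norm_vertical)

text \<open>Halving the larger argument finitely often reaches the range of \<open>step\<close>;
  consecutive signs agree along this chain.\<close>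

lemma doubling_chain_same_sign:
  fixes g :: "real \<Rightarrow> real"
  assumes step: "\<And>t t'. 0 < t \<Longrightarrow> t \<le> t' \<Longrightarrow> t' \<le> 2 * t \<Longrightarrow> g t * g t' > 0"
    and "0 < t" "0 < t'"
  shows "g t * g t' > 0"
proof -
  have up: "g t * g t' > 0" if "0 < t" "t \<le> t'" "t' \<le> 2 ^ n * t" for n t t'
    using that(2,3)
  proof (induction n arbitrary: t')
    case 0
    then show ?case using step[OF \<open>0 < t\<close>, of t'] \<open>0 < t\<close> by simp
  next
    case (Suc n)
    show ?case
    proof (cases "t' \<le> 2 * t")
      case True
      then show ?thesis using step \<open>0 < t\<close> Suc.prems by blast
    next
      case False
      then have "g t * g (t' / 2) > 0" using Suc by auto
      moreover have "g (t' / 2) * g t' > 0" using step[of "t' / 2" t'] False \<open>0 < t\<close> by simp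
      ultimately show ?thesis by (auto simp: zero_less_mult_iff)
    qed
  qed
  have *: "g t * g t' > 0" if "0 < t" "t \<le> t'" for t t'
  proof -
    obtain n where "t' / t < 2 ^ n" using real_arch_pow[of 2 "t' / t"] by auto
    then show ?thesis using up[of t t' n] that by (simp add: field_simps)
  qed
  show ?thesis using *[of t t'] *[of t' t] assms(2,3) by (cases "t \<le> t'") (auto simp: mult.commute)
qed

context
  fixes \<epsilon> :: real and f :: "heis \<Rightarrow> heis"
  assumes \<epsilon>: "0 < \<epsilon>" "\<epsilon> \<le> 1 / 10 ^ 9" and f: "heis_bilipschitz (1 + \<epsilon>) f" "f 0 = 0"
begin

text \<open>Under \<open>\<epsilon> \<le> 1 / 10 ^ 9\<close> the linear bounds
  \<open>400000 * \<epsilon>\<close> and \<open>3000000 * \<epsilon>\<close> fall below the fixed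
  fractions that the sign arguments use.\<close>

lemma vertical_image_bounds:
  assumes "f (0, 0, T) = (X, Y, S)"
  shows "sqrt (X\<^sup>2 + Y\<^sup>2) \<le> sqrt (pi * \<bar>T\<bar>) / 1000" "\<bar>\<bar>S\<bar> - \<bar>T\<bar>\<bar> \<le> \<bar>T\<bar> / 100"
proof -
  have "sqrt (X\<^sup>2 + Y\<^sup>2) \<le> (400000 * \<epsilon>) * sqrt (pi * \<bar>T\<bar>)"
    by (rule vertical_image_horizontal_part[OF \<epsilon>(1) _ f assms]) (use \<epsilon> in simp)
  also have "\<dots> \<le> (1 / 1000) * sqrt (pi * \<bar>T\<bar>)" using \<epsilon> by (intro mult_right_mono) auto
  finally show "sqrt (X\<^sup>2 + Y\<^sup>2) \<le> sqrt (pi * \<bar>T\<bar>) / 1000" by simp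
  have "\<bar>\<bar>S\<bar> - \<bar>T\<bar>\<bar> \<le> (3000000 * \<epsilon>) * \<bar>T\<bar>" by (rule vertical_image_vertical_part[OF \<epsilon> f assms])
  also have "\<dots> \<le> (1 / 100) * \<bar>T\<bar>" using \<epsilon> by (intro mult_right_mono) auto
  finally show "\<bar>\<bar>S\<bar> - \<bar>T\<bar>\<bar> \<le> \<bar>T\<bar> / 100" by simp
qed

text \<open>If the signs differed, the heights of the images would be at least \<open>T'\<close>
  apart, so the images would have distance nearly \<open>D\<close> or more; but the original points
  have distance at most \<open>3 / 4 * D\<close>.\<close>

lemma vertical_image_same_sign_step:
  assumes T: "0 < T" "T \<le> T'" "T' \<le> 2 * T"
    and fT: "f (0, 0, T) = (X, Y, S)" "f (0, 0, T') = (X', Y', S')"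
  shows "S * S' > 0"
proof (rule ccontr)
  assume neg: "\<not> S * S' > 0"
  define D where "D = sqrt (pi * \<bar>T'\<bar>)"
  have D: "D > 0" "D\<^sup>2 = pi * T'" using T by (auto simp: D_def)
  note b = vertical_image_bounds[OF fT(1)] vertical_image_bounds[OF fT(2)]
  have TD: "sqrt (pi * \<bar>T\<bar>) \<le> D" using T by (simp add: D_def)
  have q: "sqrt (X\<^sup>2 + Y\<^sup>2) \<le> D / 1000" "sqrt (X'\<^sup>2 + Y'\<^sup>2) \<le> D / 1000"
    using b(1,3) TD unfolding D_def by linarith+
  obtain w where w: "pi * \<bar>w - (S' - S)\<bar> \<le> D\<^sup>2 / 100"
    "sqrt (pi * \<bar>w\<bar>) - D / 200 \<le> heis_dist (f (0, 0, T)) (f (0, 0, T'))"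
    by (rule near_vertical_dist[OF less_imp_le[OF D(1)] q, of S' S, folded fT]) (rule that)
  have "\<bar>S' - S\<bar> = \<bar>S\<bar> + \<bar>S'\<bar>" using neg by (auto simp: abs_if zero_less_mult_iff not_less)
  \<comment> \<open>Up to one percent \<open>|S| + |S'|\<close> is \<open>T + T'\<close>, which is
    at least \<open>3 / 2 * T'\<close>.\<close>
  then have "T' \<le> \<bar>S' - S\<bar>" using b(2,4) T by linarith
  then have "pi * T' \<le> pi * \<bar>S' - S\<bar>" by simp
  moreover have "pi * \<bar>S' - S\<bar> \<le> pi * \<bar>w - (S' - S)\<bar> + pi * \<bar>w\<bar>"
    unfolding distrib_left[symmetric] by (intro mult_left_mono) auto
  ultimately have big: "99 / 100 * D\<^sup>2 \<le> pi * \<bar>w\<bar>" using w(1) D(2) by linarith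
  \<comment> \<open>The factor \<open>3 / 4\<close> is a rational bound above
    \<open>1 / sqrt 2\<close>.\<close>
  have "pi * \<bar>T' - T\<bar> \<le> pi * (T' / 2)" using T by (intro mult_left_mono) auto
  also have "\<dots> \<le> (3 / 4 * D)\<^sup>2" using D(2) T(1,2) by (simp add: power_mult_distrib power_divide)
  finally have d: "heis_dist (0, 0, T) (0, 0, T') \<le> 3 / 4 * D"
    unfolding vertical_dist using D(1) by (intro real_le_lsqrt) auto
  have "(1 + \<epsilon>) * heis_dist (0, 0, T) (0, 0, T') \<le> 101 / 100 * (3 / 4 * D)"
    using d \<epsilon> D(1) by (intro mult_mono) (auto simp: vertical_dist)
  then have "sqrt (pi * \<bar>w\<bar>) \<le> 8 / 10 * D"
    using w(2) heis_bilipschitzD(2)[OF f(1) \<epsilon>(1), of "(0, 0, T)" "(0, 0, T')"] D(1) by linarith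
  then have "pi * \<bar>w\<bar> \<le> (8 / 10 * D)\<^sup>2" by (rule sqrt_le_D)
  then show False using big D T by (simp add: power_mult_distrib power_divide)
qed

text \<open>The points at heights \<open>T\<close> and \<open>- T\<close> are at distance at least
  \<open>D\<close>. Images with heights of the same sign would differ in height by at most
  \<open>|T| / 50\<close>, hence lie within \<open>D / 4\<close> of each other.\<close>

lemma vertical_image_opposite_sign:
  assumes "T \<noteq> 0" and fT: "f (0, 0, T) = (X, Y, S)" "f (0, 0, - T) = (X', Y', S')"
  shows "S * S' < 0"
proof (rule ccontr)
  assume pos: "\<not> S * S' < 0"
  define D where "D = sqrt (pi * \<bar>T\<bar>)"
  have D: "D > 0" "D\<^sup>2 = pi * \<bar>T\<bar>" using assms(1) by (auto simp: D_def)
  note b = vertical_image_bounds[OF fT(1)] vertical_image_bounds[OF fT(2)]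
  have q: "sqrt (X\<^sup>2 + Y\<^sup>2) \<le> D / 1000" "sqrt (X'\<^sup>2 + Y'\<^sup>2) \<le> D / 1000"
    using b(1,3) by (auto simp: D_def)
  obtain w where w: "pi * \<bar>w - (S' - S)\<bar> \<le> D\<^sup>2 / 100"
    "heis_dist (f (0, 0, T)) (f (0, 0, - T)) \<le> sqrt (pi * \<bar>w\<bar>) + D / 200"
    by (rule near_vertical_dist[OF less_imp_le[OF D(1)] q, of S' S, folded fT]) (rule that)
  have "\<bar>S' - S\<bar> = \<bar>\<bar>S'\<bar> - \<bar>S\<bar>\<bar>" using pos by (auto simp: abs_if mult_less_0_iff not_less)
  then have "\<bar>S' - S\<bar> \<le> \<bar>T\<bar> / 50" using b(2,4) by linarith
  then have "pi * \<bar>S' - S\<bar> \<le> pi * (\<bar>T\<bar> / 50)" by (intro mult_left_mono) auto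
  moreover have "pi * \<bar>w\<bar> \<le> pi * \<bar>w - (S' - S)\<bar> + pi * \<bar>S' - S\<bar>"
    unfolding distrib_left[symmetric] by (intro mult_left_mono) auto
  ultimately have "pi * \<bar>w\<bar> \<le> D\<^sup>2 / 25" using w(1) D(2) zero_le_power2[of D] by linarith
  also have "\<dots> = (D / 5)\<^sup>2" by (simp add: power_divide)
  finally have "pi * \<bar>w\<bar> \<le> (D / 5)\<^sup>2" .
  then have "sqrt (pi * \<bar>w\<bar>) \<le> D / 5" using D(1) by (intro real_le_lsqrt) auto
  then have N: "heis_dist (f (0, 0, T)) (f (0, 0, - T)) \<le> D / 4" using w(2) D(1) by linarith
  have "D \<le> heis_dist (0, 0, T) (0, 0, - T)"
    unfolding vertical_dist D_def by (simp add: abs_if)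
  also have "\<dots> \<le> (1 + \<epsilon>) * heis_dist (f (0, 0, T)) (f (0, 0, - T))"
    by (rule heis_bilipschitzD(1)[OF f(1) \<epsilon>(1)])
  also have "\<dots> \<le> 2 * (D / 4)"
  proof (intro mult_mono N)
    show "0 \<le> heis_dist (f (0, 0, T)) (f (0, 0, - T))"
      by (subst heis_dist_translate) (rule heis_norm_nonneg)
  qed (use \<epsilon> in auto)
  finally show False using D(1) by simp
qed

text \<open>The sign at height 1 propagates to all positive heights by doubling and to negative ones
  by reversal, so it decides between the two alternatives.\<close>

lemma vertical_image_sign:
  "(\<forall>T. T \<noteq> 0 \<longrightarrow> T * snd (snd (f (0, 0, T))) > 0) \<or> (\<forall>T. T \<noteq> 0 \<longrightarrow> T * snd (snd (f (0, 0, T))) < 0)"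
proof -
  define s where "s T = snd (snd (f (0, 0, T)))" for T
  have step: "s T * s T' > 0" if "0 < T" "T \<le> T'" "T' \<le> 2 * T" for T T'
    using vertical_image_same_sign_step[OF that] unfolding s_def by (metis prod.collapse)
  have opp: "s T * s (- T) < 0" if "T \<noteq> 0" for T
    using vertical_image_opposite_sign[OF that] unfolding s_def by (metis prod.collapse)
  have pos: "s 1 * s T > 0" if "T > 0" for T
    using doubling_chain_same_sign[of s 1 T] step that by simp
  have neg: "s 1 * s T < 0" if "T < 0" for T
    using pos[of "- T"] opp[of T] that by (auto simp: zero_less_mult_iff mult_less_0_iff)
  have "s 1 * (T * s T) > 0" if "T \<noteq> 0" for T
    using pos[of T] neg[of T] that by (auto simp: zero_less_mult_iff mult_less_0_iff neq_iff)
  then show ?thesis unfolding s_def[symmetric] by (cases "s 1 > 0") (auto simp: zero_less_mult_iff)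
qed

text \<open>Stated for any point that shares \<open>X^2 + Y^2\<close> and \<open>|S|\<close> with
  the image, so that it covers both \<open>f\<close> and \<open>heis_J \<circ> f\<close>. The sign
  condition turns the bound on \<open>| |S| - |T| |\<close> into one on \<open>|T - S|\<close>,
  whose square root produces the order \<open>sqrt \<epsilon>\<close>.\<close>

lemma vertical_dist_estimate:
  assumes q: "X\<^sup>2 + Y\<^sup>2 = X0\<^sup>2 + Y0\<^sup>2" "\<bar>S\<bar> = \<bar>S0\<bar>" and fT: "f (0, 0, T) = (X0, Y0, S0)"
    and sign: "T \<noteq> 0 \<Longrightarrow> T * S > 0"
  shows "heis_dist (X, Y, S) (0, 0, T) \<le> 500000 * \<epsilon> powr (1 / 32) * heis_dist (0, 0, 0) (0, 0, T)"
proof -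
  define D where "D = sqrt (pi * \<bar>T\<bar>)"
  have D: "D \<ge> 0" by (simp add: D_def)
  have horiz: "sqrt (X\<^sup>2 + Y\<^sup>2) \<le> 400000 * \<epsilon> * D"
    unfolding q D_def by (rule vertical_image_horizontal_part[OF \<epsilon>(1) _ f fT]) (use \<epsilon> in simp)
  have vert: "\<bar>\<bar>S\<bar> - \<bar>T\<bar>\<bar> \<le> 3000000 * \<epsilon> * \<bar>T\<bar>"
    unfolding q by (rule vertical_image_vertical_part[OF \<epsilon> f fT])
  have "\<bar>T - S\<bar> = \<bar>\<bar>S\<bar> - \<bar>T\<bar>\<bar>"
  proof (cases "T = 0")
    case True
    then show ?thesis using vert by simp
  next
    case False
    then show ?thesis using sign by (auto simp: abs_if zero_less_mult_iff)
  qed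
  then have "pi * \<bar>T - S\<bar> \<le> pi * (3000000 * \<epsilon> * \<bar>T\<bar>)" using vert by simp
  then have "sqrt (pi * \<bar>T - S\<bar>) \<le> sqrt (3000000 * \<epsilon> * (pi * \<bar>T\<bar>))"
    by (simp add: mult.left_commute)
  also have "\<dots> = sqrt 3000000 * sqrt \<epsilon> * D" by (simp add: real_sqrt_mult D_def)
  also have "\<dots> \<le> 2000 * sqrt \<epsilon> * D"
    using D \<epsilon> by (intro mult_right_mono real_le_lsqrt) auto
  finally have "sqrt (pi * \<bar>T - S\<bar>) \<le> 2000 * sqrt \<epsilon> * D" .
  moreover have "heis_dist (X, Y, S) (0, 0, T) \<le> sqrt (X\<^sup>2 + Y\<^sup>2) + sqrt (pi * \<bar>T - S\<bar>)"
    using heis_norm_le[of "- X" "- Y" "T - S"] by (simp add: heis_dist_coords)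
  moreover note horiz
  ultimately have 1: "heis_dist (X, Y, S) (0, 0, T) \<le> 400000 * (\<epsilon> * D) + 2000 * (sqrt \<epsilon> * D)"
    by (simp add: mult.assoc)
  \<comment> \<open>For \<open>\<epsilon>\<close> below 1 smaller exponents give larger powers, so
    both error terms are absorbed; \<open>400000 + 2000\<close> is below the final constant
    500000.\<close>
  have "\<epsilon> powr 1 \<le> \<epsilon> powr (1 / 32)" "\<epsilon> powr (1 / 2) \<le> \<epsilon> powr (1 / 32)"
    by (rule powr_mono'; use \<epsilon> in simp)+
  then have "\<epsilon> \<le> \<epsilon> powr (1 / 32)" "sqrt \<epsilon> \<le> \<epsilon> powr (1 / 32)" using \<epsilon> by (auto simp: powr_half_sqrt)
  then have "\<epsilon> * D \<le> \<epsilon> powr (1 / 32) * D" "sqrt \<epsilon> * D \<le> \<epsilon> powr (1 / 32) * D"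
    using D by (auto intro!: mult_right_mono)
  moreover have "\<epsilon> powr (1 / 32) * D \<ge> 0" using D by simp
  ultimately have "heis_dist (X, Y, S) (0, 0, T) \<le> 500000 * (\<epsilon> powr (1 / 32) * D)" using 1 by linarith
  moreover have "heis_dist (0, 0, 0) (0, 0, T) = D" using vertical_dist[of 0 T] by (simp add: D_def)
  ultimately show ?thesis by (simp add: mult.assoc)
qed

end

theorem theoremC:
  shows "\<exists>\<epsilon>\<^sub>0>0. \<exists>C>0. \<forall>(\<epsilon>::real) (f :: heis \<Rightarrow> heis).
           0 < \<epsilon> \<longrightarrow> \<epsilon> < \<epsilon>\<^sub>0 \<longrightarrow> heis_bilipschitz (1 + \<epsilon>) f \<longrightarrow> f 0 = 0 \<longrightarrow>
           (\<exists>g\<in>{f, heis_J \<circ> f}. \<forall>t::real.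
              heis_dist (g (0, 0, t)) (0, 0, t)
                \<le> C * \<epsilon> powr (1 / 32) * heis_dist (0, 0, 0) (0, 0, t))"
proof (rule exI[of _ "1 / 10 ^ 9"], intro conjI exI[of _ 500000] allI impI)
  fix \<epsilon> :: real and f :: "heis \<Rightarrow> heis"
  assume \<epsilon>: "0 < \<epsilon>" "\<epsilon> < 1 / 10 ^ 9" and f: "heis_bilipschitz (1 + \<epsilon>) f" "f 0 = 0"
  note est = vertical_dist_estimate[OF \<epsilon>(1) less_imp_le[OF \<epsilon>(2)] f]
  have split: "f (0, 0, t) = (fst (f (0, 0, t)), fst (snd (f (0, 0, t))), snd (snd (f (0, 0, t))))" for t
    by simp
  from vertical_image_sign[OF \<epsilon>(1) less_imp_le[OF \<epsilon>(2)] f]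
  show "\<exists>g\<in>{f, heis_J \<circ> f}. \<forall>t::real. heis_dist (g (0, 0, t)) (0, 0, t)
      \<le> 500000 * \<epsilon> powr (1 / 32) * heis_dist (0, 0, 0) (0, 0, t)"
  proof
    assume sign: "\<forall>T. T \<noteq> 0 \<longrightarrow> T * snd (snd (f (0, 0, T))) > 0"
    have "heis_dist (f (0, 0, t)) (0, 0, t) \<le> 500000 * \<epsilon> powr (1 / 32) * heis_dist (0, 0, 0) (0, 0, t)" for t
      by (subst split) (rule est[OF refl refl split], use sign in blast)
    then show ?thesis by blast
  next
    assume sign: "\<forall>T. T \<noteq> 0 \<longrightarrow> T * snd (snd (f (0, 0, T))) < 0"
    have "heis_dist (heis_J (f (0, 0, t))) (0, 0, t) \<le> 500000 * \<epsilon> powr (1 / 32) * heis_dist (0, 0, 0) (0, 0, t)" for t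
    proof -
      have J: "heis_J (f (0, 0, t)) = (fst (f (0, 0, t)), - fst (snd (f (0, 0, t))), - snd (snd (f (0, 0, t))))"
        by (simp add: heis_J_def case_prod_unfold)
      \<comment> \<open>\<open>heis_J\<close> preserves \<open>X^2 + Y^2\<close> and
        \<open>|S|\<close> and reverses the sign of the height, which makes \<open>T * S\<close>
        positive.\<close>
      show ?thesis unfolding J by (rule est[OF _ _ split]) (use sign in auto)
    qed
    then show ?thesis by auto
  qed
qed auto

end
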